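(* Let $R$ be a ring and let $\pi : R\to R/\mathfrak{l}^s_R$, $r\mapsto r+\mathfrak{l}^s_R$. Then 1. $Q_l^s(Q_l^s(R))=Q_l^s(R)$. 2. $T_l(R/\mathfrak{l}^s_R)=\pi(T_l(R))$ and $T_l(R)=\pi^{-1}(T_l(R/\mathfrak{l}^s_R))$. 3. $T_l(R/\mathfrak{l}^s_R)=S_{l,0}(R/\mathfrak{l}^s_R)$. 4. $\mathfrak{l}^s_{R/\mathfrak{l}^s_R}=0$. 5. $T_l(Q_l^s(R))=Q_l^s(R)^*$ and $\mathfrak{l}^s_{Q_l^s(R)}=0$. 6. $\pi(\mathcal{L}^s_l(R))=\mathcal{L}^s_l(R/\mathfrak{l}^s_R)$ and $\mathcal{L}^s_l(R)=\pi^{-1}(\mathcal{L}^s_l(R/\mathfrak{l}^s_R))$. 7. $Q_l^s(R/\mathfrak{l}^s_R)=Q_l(R/\mathfrak{l}^s_R)$.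
   Context: Rings are associative with $1$ and nonzero; $A^*$ denotes the group of units of a ring $A$. A multiplicative subset $S$ of $R$ is a submonoid of $(R,\cdot)$ with $1\in S$, $0\notin S$. It is a left Ore set if $Sr\cap Rs\neq\emptyset$ for all $r\in R$, $s\in S$; then $\mathrm{ass}(S):=\{r\in R\mid sr=0 \text{ for some } s\in S\}$ is an ideal. A left Ore set $S$ is a left denominator set if $rs=0$ with $r\in R$, $s\in S$ implies $r\in\mathrm{ass}(S)$. $\mathrm{Den}_l(R)$ is the set of left denominator sets of $R$; for $S\in\mathrm{Den}_l(R)$, $S^{-1}R=\{s^{-1}r\mid s\in S,r\in R\}$ is the left localization. $\mathrm{max.Den}_l(R)$ is the (non-empty) set of elements of $\mathrm{Den}_l(R)$ maximal under inclusion. $\mathcal{L}^s_l(R):=\bigcap_{S\in \mathrm{max.Den}_l(R)}S$. $T_l(R)$ is the union of all $S\in\mathrm{Den}_l(R)$ with $S\subseteq\mathcal{L}^s_l(R)$; it is the largest left denominator set of $R$ contained in $\mathcal{L}^s_l(R)$. $Q_l^s(R):=T_l(R)^{-1}R$ and $\mathfrak{l}^s_R:=\mathrm{ass}(T_l(R))$. $S_{l,0}(R)$ is the largest (under inclusion) left denominator set $S$ of $R$ with $\mathrm{ass}(S)=0$ (it exists), and $Q_l(R):=S_{l,0}(R)^{-1}R$. Equality between localizations in item 1 means that the canonical homomorphism $Q_l^s(R)\to Q_l^s(Q_l^s(R))$, $q\mapsto\frac{q}{1}$, is an isomorphism, used as an identification. *)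

theory Defs
  imports "HOL-Algebra.QuotRing"
begin

definition multiplicative_subset :: "('a, 'm) ring_scheme \<Rightarrow> 'a set \<Rightarrow> bool" where
  "multiplicative_subset R S \<longleftrightarrow> submonoid S R \<and> \<zero>\<^bsub>R\<^esub> \<notin> S"

text \<open>Below, \<open>S #>\<^bsub>R\<^esub> r\<close> is the set \<open>Sr\<close> of multiplicative translates.\<close>

definition left_ore_set :: "('a, 'm) ring_scheme \<Rightarrow> 'a set \<Rightarrow> bool" where
  "left_ore_set R S \<longleftrightarrow> multiplicative_subset R S \<and>
     (\<forall>r\<in>carrier R. \<forall>s\<in>S. (S #>\<^bsub>R\<^esub> r) \<inter> (carrier R #>\<^bsub>R\<^esub> s) \<noteq> {})"

definition ass :: "('a, 'm) ring_scheme \<Rightarrow> 'a set \<Rightarrow> 'a set" where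
  "ass R S = {r \<in> carrier R. \<exists>s\<in>S. s \<otimes>\<^bsub>R\<^esub> r = \<zero>\<^bsub>R\<^esub>}"

definition Den_l :: "('a, 'm) ring_scheme \<Rightarrow> 'a set set" where
  "Den_l R = {S. left_ore_set R S \<and>
     (\<forall>r\<in>carrier R. \<forall>s\<in>S. r \<otimes>\<^bsub>R\<^esub> s = \<zero>\<^bsub>R\<^esub> \<longrightarrow> r \<in> ass R S)}"

definition max_Den_l :: "('a, 'm) ring_scheme \<Rightarrow> 'a set set" where
  "max_Den_l R = {S \<in> Den_l R. \<forall>S'\<in>Den_l R. S \<subseteq> S' \<longrightarrow> S' = S}"

text \<open>
  The left localization \<open>S\<inverse>R\<close> of \<open>R\<close> at a left denominator set \<open>S\<close>. The pair \<open>(s, r)\<close> stands for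
  the left fraction \<open>s\<inverse>r\<close>; two fractions are equal iff they agree after passing to some common
  denominator \<open>cs = ds'\<close>. The multipliers \<open>c\<close> and \<open>d\<close> range over \<open>R\<close>, only \<open>cs\<close> has to lie
  in \<open>S\<close>.
\<close>

definition ore_rel :: "('a, 'm) ring_scheme \<Rightarrow> 'a set \<Rightarrow> (('a \<times> 'a) \<times> ('a \<times> 'a)) set" where
  "ore_rel R S = {((s, r), (s', r')). s \<in> S \<and> r \<in> carrier R \<and> s' \<in> S \<and> r' \<in> carrier R \<and>
     (\<exists>c\<in>carrier R. \<exists>d\<in>carrier R.
        c \<otimes>\<^bsub>R\<^esub> s \<in> S \<and> c \<otimes>\<^bsub>R\<^esub> s = d \<otimes>\<^bsub>R\<^esub> s' \<and> c \<otimes>\<^bsub>R\<^esub> r = d \<otimes>\<^bsub>R\<^esub> r')}"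

definition left_frac :: "('a, 'm) ring_scheme \<Rightarrow> 'a set \<Rightarrow> 'a \<Rightarrow> 'a \<Rightarrow> ('a \<times> 'a) set" where
  "left_frac R S s r = ore_rel R S `` {(s, r)}"

text \<open>
  The operations are
  \<open>s\<inverse>r \<cdot> s'\<inverse>r' = (ts)\<inverse>(xr')\<close> for any \<open>t \<in> S\<close>, \<open>x \<in> R\<close> with \<open>tr = xs'\<close>, and
  \<open>s\<inverse>r + s'\<inverse>r' = (cs)\<inverse>(cr + dr')\<close> for any \<open>c, d \<in> R\<close> with \<open>cs = ds' \<in> S\<close>.
  If \<open>S\<close> is a left denominator set, the result does not depend on the choices, so each union
  below is taken over a single equivalence class.
\<close>

definition left_localization :: "('a, 'm) ring_scheme \<Rightarrow> 'a set \<Rightarrow> ('a \<times> 'a) set ring" where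
  "left_localization R S =
    \<lparr>carrier = (S \<times> carrier R) // ore_rel R S,
     mult = (\<lambda>X Y. \<Union> {left_frac R S (t \<otimes>\<^bsub>R\<^esub> s) (x \<otimes>\<^bsub>R\<^esub> r') | s r s' r' t x.
        (s, r) \<in> X \<and> (s', r') \<in> Y \<and> t \<in> S \<and> x \<in> carrier R \<and>
        t \<otimes>\<^bsub>R\<^esub> r = x \<otimes>\<^bsub>R\<^esub> s'}),
     one = left_frac R S \<one>\<^bsub>R\<^esub> \<one>\<^bsub>R\<^esub>,
     zero = left_frac R S \<one>\<^bsub>R\<^esub> \<zero>\<^bsub>R\<^esub>,
     add = (\<lambda>X Y. \<Union> {left_frac R S (c \<otimes>\<^bsub>R\<^esub> s) (c \<otimes>\<^bsub>R\<^esub> r \<oplus>\<^bsub>R\<^esub> d \<otimes>\<^bsub>R\<^esub> r') | s r s' r' c d.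
        (s, r) \<in> X \<and> (s', r') \<in> Y \<and> c \<in> carrier R \<and> d \<in> carrier R \<and>
        c \<otimes>\<^bsub>R\<^esub> s \<in> S \<and> c \<otimes>\<^bsub>R\<^esub> s = d \<otimes>\<^bsub>R\<^esub> s'})\<rparr>"

definition to_localization :: "('a, 'm) ring_scheme \<Rightarrow> 'a set \<Rightarrow> 'a \<Rightarrow> ('a \<times> 'a) set" where
  "to_localization R S r = left_frac R S \<one>\<^bsub>R\<^esub> r"

definition Lls :: "('a, 'm) ring_scheme \<Rightarrow> 'a set" where
  "Lls R = \<Inter> (max_Den_l R)"

definition T_l :: "('a, 'm) ring_scheme \<Rightarrow> 'a set" where
  "T_l R = \<Union> {S \<in> Den_l R. S \<subseteq> Lls R}"

definition Qls :: "('a, 'm) ring_scheme \<Rightarrow> ('a \<times> 'a) set ring" where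
  "Qls R = left_localization R (T_l R)"

definition lls :: "('a, 'm) ring_scheme \<Rightarrow> 'a set" where
  "lls R = ass R (T_l R)"

definition S_l0 :: "('a, 'm) ring_scheme \<Rightarrow> 'a set" where
  "S_l0 R = (GREATEST S. S \<in> Den_l R \<and> ass R S = {\<zero>\<^bsub>R\<^esub>})"

definition Ql :: "('a, 'm) ring_scheme \<Rightarrow> ('a \<times> 'a) set ring" where
  "Ql R = left_localization R (S_l0 R)"

end

theory Submission
  imports Defs "HOL-Algebra.Multiplicative_Group"
begin

text \<open>
  Let \<open>h : R \<rightarrow> Q\<close> be one of the maps \<open>R \<rightarrow> R / ass T\<close> and \<open>R \<rightarrow> T\<inverse>R\<close>, where \<open>T = T\<^sub>l(R)\<close>. If \<open>S\<close> is a left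
  denominator set of \<open>R\<close> containing \<open>T\<close>, so is \<open>h(S)\<close> in \<open>Q\<close>, and if \<open>D\<close> is a left denominator set of
  \<open>Q\<close> containing \<open>h(T)\<close>, so is \<open>h\<inverse>(D)\<close> in \<open>R\<close>. A left denominator set with zero \<open>ass\<close>, such as \<open>h(T)\<close>
  or the group of units, lies in every maximal one, because the submonoid generated by the two is
  again a left denominator set. Hence every maximal left denominator set of \<open>R\<close> is the preimage of
  a maximal one of \<open>Q\<close>, and \<open>h\<inverse>(T\<^sub>l(Q))\<close>, being a left denominator set contained in all of them,
  equals \<open>T\<close>. Since \<open>h\<close> is surjective up to denominators from \<open>T\<close>, this determines \<open>T\<^sub>l(Q)\<close>.
\<close>

section \<open>Left denominator sets\<close>

text \<open>Replaces the coset intersection and the set \<open>ass R S\<close> by equations between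
  elements, the form in which the later denominator sets are verified.\<close>

lemma Den_l_I:
  fixes R (structure)
  assumes "S \<subseteq> carrier R" "\<one> \<in> S" "\<zero> \<notin> S"
    and "\<And>x y. x \<in> S \<Longrightarrow> y \<in> S \<Longrightarrow> x \<otimes> y \<in> S"
    and "\<And>r s. r \<in> carrier R \<Longrightarrow> s \<in> S \<Longrightarrow> \<exists>t\<in>S. \<exists>x\<in>carrier R. t \<otimes> r = x \<otimes> s"
    and "\<And>r s. r \<in> carrier R \<Longrightarrow> s \<in> S \<Longrightarrow> r \<otimes> s = \<zero> \<Longrightarrow> \<exists>t\<in>S. t \<otimes> r = \<zero>"
  shows "S \<in> Den_l R"
proof -
  have "submonoid S R"
    using assms(1,2,4) by (intro submonoid.intro) auto
  moreover have "(S #> r) \<inter> (carrier R #> s) \<noteq> {}" if rs: "r \<in> carrier R" "s \<in> S" for r s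
  proof -
    obtain t x where "t \<in> S" "x \<in> carrier R" "t \<otimes> r = x \<otimes> s"
      using assms(5)[OF rs] by blast
    then have "t \<otimes> r \<in> (S #> r) \<inter> (carrier R #> s)"
      unfolding r_coset_def by blast
    then show ?thesis by blast
  qed
  ultimately show ?thesis
    using assms(3,6)
    unfolding Den_l_def left_ore_set_def multiplicative_subset_def ass_def by blast
qed

lemma
  fixes R (structure)
  assumes "S \<in> Den_l R"
  shows Den_l_subset: "S \<subseteq> carrier R"
    and Den_l_one: "\<one> \<in> S"
    and Den_l_zero: "\<zero> \<notin> S"
    and Den_l_mult: "x \<in> S \<Longrightarrow> y \<in> S \<Longrightarrow> x \<otimes> y \<in> S"
    and Den_l_ore: "r \<in> carrier R \<Longrightarrow> s \<in> S \<Longrightarrow> \<exists>t\<in>S. \<exists>x\<in>carrier R. t \<otimes> r = x \<otimes> s"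
    and Den_l_reversible:
      "r \<in> carrier R \<Longrightarrow> s \<in> S \<Longrightarrow> r \<otimes> s = \<zero> \<Longrightarrow> \<exists>t\<in>S. t \<otimes> r = \<zero>"
proof -
  have S: "submonoid S R" "\<zero> \<notin> S"
    and ore: "\<forall>r\<in>carrier R. \<forall>s\<in>S. (S #> r) \<inter> (carrier R #> s) \<noteq> {}"
    and rev: "\<forall>r\<in>carrier R. \<forall>s\<in>S. r \<otimes> s = \<zero> \<longrightarrow> r \<in> ass R S"
    using assms unfolding Den_l_def left_ore_set_def multiplicative_subset_def by auto
  show "S \<subseteq> carrier R" "\<one> \<in> S" "\<zero> \<notin> S" "x \<in> S \<Longrightarrow> y \<in> S \<Longrightarrow> x \<otimes> y \<in> S"
    using S by (auto simp: submonoid_def)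
  show "\<exists>t\<in>S. \<exists>x\<in>carrier R. t \<otimes> r = x \<otimes> s" if "r \<in> carrier R" "s \<in> S"
  proof -
    have "(S #> r) \<inter> (carrier R #> s) \<noteq> {}" using ore that by blast
    then show ?thesis unfolding r_coset_def by auto
  qed
  show "\<exists>t\<in>S. t \<otimes> r = \<zero>" if "r \<in> carrier R" "s \<in> S" "r \<otimes> s = \<zero>"
    using rev that unfolding ass_def by blast
qed

lemma ass_subset: "ass R S \<subseteq> carrier R"
  unfolding ass_def by blast

section \<open>Calculation in a fixed left denominator set and the ideal
  \<open>ass R S\<close>\<close>

locale left_denominator = ring R for R (structure) +
  fixes S
  assumes den: "S \<in> Den_l R"
begin

lemmas one_in [simp, intro] = Den_l_one[OF den]
  and zero_notin = Den_l_zero[OF den]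
  and mult_in [simp, intro] = Den_l_mult[OF den]
  and ore = Den_l_ore[OF den]
  and reversible = Den_l_reversible[OF den]

lemma in_carrier [simp]: "s \<in> S \<Longrightarrow> s \<in> carrier R"
  using Den_l_subset[OF den] by blast

lemma oreE:
  assumes "r \<in> carrier R" "s \<in> S"
  obtains t x where "t \<in> S" "x \<in> carrier R" "t \<otimes> r = x \<otimes> s"
  using ore[OF assms] by blast

text \<open>Reversibility applied to \<open>a \<ominus> b\<close>: a right factor from
  \<open>S\<close> may be dropped at the cost of a new left factor from \<open>S\<close>.\<close>

lemma cancel_right:
  assumes "a \<in> carrier R" "b \<in> carrier R" "s \<in> S" "a \<otimes> s = b \<otimes> s"
  obtains u where "u \<in> S" "u \<otimes> a = u \<otimes> b"
proof -
  have "(a \<ominus> b) \<otimes> s = \<zero>"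
    using assms by (simp add: minus_eq l_distr l_minus r_neg)
  then obtain u where u: "u \<in> S" "u \<otimes> (a \<ominus> b) = \<zero>"
    using reversible[of "a \<ominus> b" s] assms by auto
  then have "u \<otimes> a \<ominus> u \<otimes> b = \<zero>"
    using assms by (simp add: minus_eq r_distr r_minus)
  then have "u \<otimes> a = u \<otimes> b"
    using assms u by simp
  with u that show thesis by blast
qed

lemma mem_assI: "s \<in> S \<Longrightarrow> r \<in> carrier R \<Longrightarrow> s \<otimes> r = \<zero> \<Longrightarrow> r \<in> ass R S"
  unfolding ass_def by blast

lemma mem_assE:
  assumes "r \<in> ass R S"
  obtains s where "s \<in> S" "r \<in> carrier R" "s \<otimes> r = \<zero>"
  using assms unfolding ass_def by blast

text \<open>The Ore condition carries an annihilator of \<open>a\<close> past \<open>r\<close>, and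
  it gives two annihilators a common left multiple in \<open>S\<close>, which kills the sum.\<close>

lemma ass_ideal: "ideal (ass R S) R"
proof (rule idealI)
  show "ring R" by (rule ring_axioms)
  show lmult: "r \<otimes> a \<in> ass R S" if ar: "a \<in> ass R S" "r \<in> carrier R" for a r
  proof -
    obtain s where s: "s \<in> S" "a \<in> carrier R" "s \<otimes> a = \<zero>"
      using mem_assE[OF ar(1)] by blast
    obtain t x where t: "t \<in> S" "x \<in> carrier R" "t \<otimes> r = x \<otimes> s"
      using oreE[OF ar(2) s(1)] by blast
    have "t \<otimes> (r \<otimes> a) = (t \<otimes> r) \<otimes> a"
      using t(1) s(2) ar(2) by (simp add: m_assoc)
    also have "\<dots> = x \<otimes> (s \<otimes> a)"
      unfolding t(3) using t(2) s(1,2) by (simp add: m_assoc)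
    finally have "t \<otimes> (r \<otimes> a) = \<zero>"
      unfolding s(3) using t(2) by simp
    then show ?thesis using mem_assI[OF t(1)] s(2) ar(2) by simp
  qed
  show "a \<otimes> x \<in> ass R S" if ax: "a \<in> ass R S" "x \<in> carrier R" for a x
  proof -
    obtain s where s: "s \<in> S" "a \<in> carrier R" "s \<otimes> a = \<zero>"
      using mem_assE[OF ax(1)] by blast
    have "s \<otimes> (a \<otimes> x) = s \<otimes> a \<otimes> x" using s(1,2) ax(2) by (simp add: m_assoc)
    then show ?thesis using mem_assI[OF s(1)] s ax(2) by simp
  qed
  show "subgroup (ass R S) (add_monoid R)"
  proof
    show "ass R S \<subseteq> carrier (add_monoid R)" using ass_subset[of R S] by simp
    show "\<one>\<^bsub>add_monoid R\<^esub> \<in> ass R S"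
      using mem_assI[of \<one> \<zero>] by simp
    show "x \<otimes>\<^bsub>add_monoid R\<^esub> y \<in> ass R S" if xy: "x \<in> ass R S" "y \<in> ass R S" for x y
    proof -
      obtain s where s: "s \<in> S" "x \<in> carrier R" "s \<otimes> x = \<zero>"
        using mem_assE[OF xy(1)] by blast
      obtain s' where s': "s' \<in> S" "y \<in> carrier R" "s' \<otimes> y = \<zero>"
        using mem_assE[OF xy(2)] by blast
      obtain t z where t: "t \<in> S" "z \<in> carrier R" "t \<otimes> s = z \<otimes> s'"
        using oreE[of s s'] s(1) s'(1) by auto
      have "(t \<otimes> s) \<otimes> x = \<zero>" using t(1,2) s by (simp add: m_assoc)
      moreover have "(t \<otimes> s) \<otimes> y = \<zero>"
        unfolding t(3) using t(1,2) s' by (simp add: m_assoc)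
      ultimately have "(t \<otimes> s) \<otimes> (x \<oplus> y) = \<zero>"
        using t(1,2) s(1,2) s'(1,2) by (simp add: r_distr)
      then show ?thesis using mem_assI[of "t \<otimes> s" "x \<oplus> y"] t(1) s(1,2) s'(2) by simp
    qed
    show "inv\<^bsub>add_monoid R\<^esub> x \<in> ass R S" if "x \<in> ass R S" for x
    proof -
      have "\<ominus> x = \<ominus> \<one> \<otimes> x" using that ass_subset[of R S] by (auto simp: l_minus)
      then have "\<ominus> x \<in> ass R S" using lmult[OF that, of "\<ominus> \<one>"] by simp
      then show ?thesis by (simp add: a_inv_def)
    qed
  qed
qed

end

section \<open>The ring of left fractions\<close>

context left_denominator
begin

abbreviation frac where "frac \<equiv> left_frac R S"
abbreviation Loc where "Loc \<equiv> left_localization R S"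

text \<open>Whatever multipliers \<open>a\<close>, \<open>b\<close> bring two representatives of a fraction to the same denominator,
  the numerators agree up to a factor in \<open>S\<close>. Applied once to each argument, this makes all the
  operations independent of the choices.\<close>

lemma cross_multiply:
  assumes rel: "((s, r), (s', r')) \<in> ore_rel R S"
    and ab: "a \<in> carrier R" "b \<in> carrier R" "a \<otimes> s = b \<otimes> s'"
  obtains w where "w \<in> S" "w \<otimes> (a \<otimes> r) = w \<otimes> (b \<otimes> r')"
proof -
  obtain c d where c: "s \<in> S" "s' \<in> S" "r \<in> carrier R" "r' \<in> carrier R" "c \<in> carrier R"
    "d \<in> carrier R" "c \<otimes> s \<in> S" "c \<otimes> s = d \<otimes> s'" "c \<otimes> r = d \<otimes> r'"
    using rel unfolding ore_rel_def by blast
  \<comment> \<open>The given multipliers \<open>a\<close>, \<open>b\<close> are compared with the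
    multipliers \<open>c\<close>, \<open>d\<close> that witness the relation: \<open>w\<close> and
    \<open>y\<close> bring both pairs to the same denominator.\<close>
  obtain w y where w: "w \<in> S" "y \<in> carrier R" "w \<otimes> (a \<otimes> s) = y \<otimes> (c \<otimes> s)"
    using oreE[of "a \<otimes> s" "c \<otimes> s"] c ab by auto
  have "(w \<otimes> a) \<otimes> s = (y \<otimes> c) \<otimes> s"
    using w c ab by (simp add: m_assoc)
  then obtain u where u: "u \<in> S" "u \<otimes> (w \<otimes> a) = u \<otimes> (y \<otimes> c)"
    using cancel_right[of "w \<otimes> a" "y \<otimes> c" s] c w ab by auto
  \<comment> \<open>Dropping \<open>s\<close> has matched \<open>w \<otimes> a\<close> with
    \<open>y \<otimes> c\<close> up to a left factor. Dropping \<open>s'\<close> now matches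
    \<open>w \<otimes> b\<close> with \<open>y \<otimes> d\<close>, so that
    \<open>c \<otimes> r = d \<otimes> r'\<close> links the two numerators.\<close>
  have "w \<otimes> b \<otimes> s' = y \<otimes> d \<otimes> s'"
    using w c ab by (simp add: m_assoc)
  then have "u \<otimes> (w \<otimes> b) \<otimes> s' = u \<otimes> (y \<otimes> d) \<otimes> s'"
    using u c w ab by (simp add: m_assoc)
  then obtain v where v: "v \<in> S" "v \<otimes> (u \<otimes> (w \<otimes> b)) = v \<otimes> (u \<otimes> (y \<otimes> d))"
    using cancel_right[of "u \<otimes> (w \<otimes> b)" "u \<otimes> (y \<otimes> d)" s'] c u w ab by auto
  have "(v \<otimes> (u \<otimes> w)) \<otimes> (a \<otimes> r) = v \<otimes> (u \<otimes> (w \<otimes> a)) \<otimes> r"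
    using u(1) v(1) w(1,2) c(1-6) ab(1,2) by (simp add: m_assoc)
  also have "\<dots> = v \<otimes> (u \<otimes> (y \<otimes> (c \<otimes> r)))"
    unfolding u(2) using u(1) v(1) w(1,2) c(1-6) ab(1,2) by (simp add: m_assoc)
  also have "\<dots> = v \<otimes> (u \<otimes> (y \<otimes> d)) \<otimes> r'"
    unfolding c(9) using u(1) v(1) w(1,2) c(1-6) ab(1,2) by (simp add: m_assoc)
  also have "\<dots> = (v \<otimes> (u \<otimes> w)) \<otimes> (b \<otimes> r')"
    unfolding v(2)[symmetric] using u(1) v(1) w(1,2) c(1-6) ab(1,2) by (simp add: m_assoc)
  finally show thesis
    using that[of "v \<otimes> (u \<otimes> w)"] u v w by auto
qed

lemma ore_relI:
  assumes "s \<in> S" "r \<in> carrier R" "s' \<in> S" "r' \<in> carrier R" "c \<in> carrier R" "d \<in> carrier R"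
    "c \<otimes> s \<in> S" "c \<otimes> s = d \<otimes> s'" "c \<otimes> r = d \<otimes> r'"
  shows "((s, r), (s', r')) \<in> ore_rel R S"
  unfolding ore_rel_def mem_Collect_eq prod.case using assms by blast

lemma equiv_ore_rel: "equiv (S \<times> carrier R) (ore_rel R S)"
proof (rule equivI)
  show "ore_rel R S \<subseteq> (S \<times> carrier R) \<times> (S \<times> carrier R)"
    unfolding ore_rel_def by auto
  show "refl_on (S \<times> carrier R) (ore_rel R S)"
    unfolding refl_on_def ore_rel_def by force
  show "sym (ore_rel R S)"
    unfolding sym_def ore_rel_def by (clarsimp) metis
  show "trans (ore_rel R S)"
  proof (rule transI, clarify)
    fix s r s' r' s'' r''
    assume 1: "((s, r), (s', r')) \<in> ore_rel R S" and 2: "((s', r'), (s'', r'')) \<in> ore_rel R S"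
    then have in_S: "s \<in> S" "s' \<in> S" "s'' \<in> S"
      and in_R: "r \<in> carrier R" "r' \<in> carrier R" "r'' \<in> carrier R"
      unfolding ore_rel_def by auto
    \<comment> \<open>Two uses of the Ore condition give a common left multiple of all three
      denominators. \<open>cross_multiply\<close> then equates the numerators for one relation at a
      time, and the factor \<open>w\<close> from the first is carried into the second.\<close>
    obtain t x where t: "t \<in> S" "x \<in> carrier R" "t \<otimes> s = x \<otimes> s'"
      using oreE[of s s'] in_S by auto
    obtain t' y where t': "t' \<in> S" "y \<in> carrier R" "t' \<otimes> (t \<otimes> s) = y \<otimes> s''"
      using oreE[of "t \<otimes> s" s''] in_S t by auto
    have "(t' \<otimes> t) \<otimes> s = (t' \<otimes> x) \<otimes> s'"
      using t t' in_S by (simp add: m_assoc)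
    then obtain w where w: "w \<in> S" "w \<otimes> ((t' \<otimes> t) \<otimes> r) = w \<otimes> ((t' \<otimes> x) \<otimes> r')"
      using cross_multiply[OF 1, of "t' \<otimes> t" "t' \<otimes> x"] t t' by auto
    have "(w \<otimes> (t' \<otimes> x)) \<otimes> s' = (w \<otimes> y) \<otimes> s''"
      using t t' w in_S by (simp add: m_assoc)
    then obtain v where v: "v \<in> S" "v \<otimes> ((w \<otimes> (t' \<otimes> x)) \<otimes> r') = v \<otimes> ((w \<otimes> y) \<otimes> r'')"
      using cross_multiply[OF 2, of "w \<otimes> (t' \<otimes> x)" "w \<otimes> y"] t t' w by auto
    have "(v \<otimes> w \<otimes> t' \<otimes> t) \<otimes> s = (v \<otimes> w \<otimes> y) \<otimes> s''"
      using t t' w v in_S by (simp add: m_assoc)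
    moreover have "(v \<otimes> w \<otimes> t' \<otimes> t) \<otimes> r = (v \<otimes> w \<otimes> y) \<otimes> r''"
      using t t' w v in_S in_R by (simp add: m_assoc)
    moreover have "(v \<otimes> w \<otimes> t' \<otimes> t) \<otimes> s \<in> S"
      using t t' w v in_S by auto
    ultimately show "((s, r), (s'', r'')) \<in> ore_rel R S"
      by (intro ore_relI[of _ _ _ _ "v \<otimes> w \<otimes> t' \<otimes> t" "v \<otimes> w \<otimes> y"])
        (use t(1,2) t'(1,2) v(1) w(1) in_S in_R in auto)
  qed
qed

section \<open>Fractions as equivalence classes and the operations on them\<close>

lemma mem_frac_iff: "(s', r') \<in> frac s r \<longleftrightarrow> ((s, r), (s', r')) \<in> ore_rel R S"
  unfolding left_frac_def by auto

lemma mem_frac_self: "s \<in> S \<Longrightarrow> r \<in> carrier R \<Longrightarrow> (s, r) \<in> frac s r"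
  unfolding left_frac_def by (rule equiv_class_self[OF equiv_ore_rel]) simp

lemma frac_eq_iff:
  assumes "s \<in> S" "r \<in> carrier R" "s' \<in> S" "r' \<in> carrier R"
  shows "frac s r = frac s' r' \<longleftrightarrow> ((s, r), (s', r')) \<in> ore_rel R S"
  unfolding left_frac_def using equiv_ore_rel assms by (simp add: eq_equiv_class_iff)

lemma frac_eqI:
  assumes "s \<in> S" "r \<in> carrier R" "s' \<in> S" "r' \<in> carrier R" "c \<in> carrier R" "d \<in> carrier R"
    "c \<otimes> s \<in> S" "c \<otimes> s = d \<otimes> s'" "c \<otimes> r = d \<otimes> r'"
  shows "frac s r = frac s' r'"
  unfolding frac_eq_iff[OF assms(1-4)] by (rule ore_relI[OF assms])

text \<open>Only \<open>c \<otimes> s\<close> has to lie in \<open>S\<close>: the Ore condition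
  produces common denominators \<open>t \<otimes> s = x \<otimes> s'\<close> in which
  \<open>x\<close> is merely an element of \<open>R\<close>.\<close>

lemma frac_expand:
  assumes "s \<in> S" "r \<in> carrier R" "c \<in> carrier R" "c \<otimes> s \<in> S"
  shows "frac (c \<otimes> s) (c \<otimes> r) = frac s r"
  by (rule frac_eqI[of _ _ _ _ \<one> c]) (use assms in auto)

lemma Loc_carrier: "carrier Loc = {frac s r | s r. s \<in> S \<and> r \<in> carrier R}"
  unfolding left_localization_def left_frac_def quotient_def by auto

lemma Loc_one: "\<one>\<^bsub>Loc\<^esub> = frac \<one> \<one>"
  and Loc_zero: "\<zero>\<^bsub>Loc\<^esub> = frac \<one> \<zero>"
  unfolding left_localization_def by auto

lemma frac_in_Loc [simp]: "s \<in> S \<Longrightarrow> r \<in> carrier R \<Longrightarrow> frac s r \<in> carrier Loc"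
  unfolding Loc_carrier by blast

lemma LocE:
  assumes "X \<in> carrier Loc"
  obtains s r where "s \<in> S" "r \<in> carrier R" "X = frac s r"
  using assms unfolding Loc_carrier by blast

text \<open>The Ore condition brings the two candidate denominators together, and
  \<open>cross_multiply\<close> makes the numerators of the first arguments agree. Since
  \<open>t \<otimes> r = x \<otimes> s'\<close>, this is an equality of denominators for the second
  arguments, so \<open>cross_multiply\<close> applies again.\<close>

lemma frac_mult_unique:
  assumes 1: "((s, r), (s1, r1)) \<in> ore_rel R S" and 2: "((s', r'), (s1', r1')) \<in> ore_rel R S"
    and t: "t \<in> S" "x \<in> carrier R" "t \<otimes> r = x \<otimes> s'"
    and t1: "t1 \<in> S" "x1 \<in> carrier R" "t1 \<otimes> r1 = x1 \<otimes> s1'"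
  shows "frac (t \<otimes> s) (x \<otimes> r') = frac (t1 \<otimes> s1) (x1 \<otimes> r1')"
proof -
  have in_S: "s \<in> S" "s1 \<in> S" "s' \<in> S" "s1' \<in> S"
    and in_R: "r \<in> carrier R" "r1 \<in> carrier R" "r' \<in> carrier R" "r1' \<in> carrier R"
    using 1 2 unfolding ore_rel_def by auto
  obtain a b where a: "a \<in> S" "b \<in> carrier R" "a \<otimes> (t \<otimes> s) = b \<otimes> (t1 \<otimes> s1)"
    using oreE[of "t \<otimes> s" "t1 \<otimes> s1"] in_S t t1 by auto
  have "(a \<otimes> t) \<otimes> s = (b \<otimes> t1) \<otimes> s1"
    using a in_S t t1 by (simp add: m_assoc)
  then obtain w where w: "w \<in> S" "w \<otimes> ((a \<otimes> t) \<otimes> r) = w \<otimes> ((b \<otimes> t1) \<otimes> r1)"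
    using cross_multiply[OF 1, of "a \<otimes> t" "b \<otimes> t1"] a t t1 by auto
  have "(w \<otimes> a \<otimes> x) \<otimes> s' = (w \<otimes> b \<otimes> x1) \<otimes> s1'"
    using w a in_S in_R t t1 by (simp add: m_assoc)
  then obtain v where v: "v \<in> S" "v \<otimes> ((w \<otimes> a \<otimes> x) \<otimes> r') = v \<otimes> ((w \<otimes> b \<otimes> x1) \<otimes> r1')"
    using cross_multiply[OF 2, of "w \<otimes> a \<otimes> x" "w \<otimes> b \<otimes> x1"] w a t t1 by auto
  show ?thesis
  proof (rule frac_eqI[of _ _ _ _ "v \<otimes> w \<otimes> a" "v \<otimes> w \<otimes> b"])
    show "(v \<otimes> w \<otimes> a) \<otimes> (x \<otimes> r') = (v \<otimes> w \<otimes> b) \<otimes> (x1 \<otimes> r1')"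
      using v w a in_S in_R t t1 by (simp add: m_assoc)
    show "(v \<otimes> w \<otimes> a) \<otimes> (t \<otimes> s) = (v \<otimes> w \<otimes> b) \<otimes> (t1 \<otimes> s1)"
      using v w a in_S in_R t t1 by (simp add: m_assoc)
  qed (use v w a in_S in_R t t1 in auto)
qed

lemma frac_mult:
  assumes "s \<in> S" "r \<in> carrier R" "s' \<in> S" "r' \<in> carrier R"
    and t: "t \<in> S" "x \<in> carrier R" "t \<otimes> r = x \<otimes> s'"
  shows "frac s r \<otimes>\<^bsub>Loc\<^esub> frac s' r' = frac (t \<otimes> s) (x \<otimes> r')"
proof -
  \<comment> \<open>The union that defines the product ranges over a family consisting of one
    fraction only.\<close>
  have "{frac (t1 \<otimes> s1) (x1 \<otimes> r1') | s1 r1 s1' r1' t1 x1.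
      (s1, r1) \<in> frac s r \<and> (s1', r1') \<in> frac s' r' \<and> t1 \<in> S \<and> x1 \<in> carrier R \<and>
      t1 \<otimes> r1 = x1 \<otimes> s1'} = {frac (t \<otimes> s) (x \<otimes> r')}" (is "?A = _")
  proof (intro equalityI subsetI)
    fix z assume "z \<in> ?A"
    then show "z \<in> {frac (t \<otimes> s) (x \<otimes> r')}"
      using frac_mult_unique[OF _ _ t] by (auto simp: mem_frac_iff)
  next
    fix z assume "z \<in> {frac (t \<otimes> s) (x \<otimes> r')}"
    then show "z \<in> ?A"
      using t mem_frac_self[OF assms(1,2)] mem_frac_self[OF assms(3,4)] by blast
  qed
  then show ?thesis
    by (simp add: left_localization_def)
qed

text \<open>As for products, except that the second use of \<open>cross_multiply\<close> gets its
  equal denominators directly from \<open>c \<otimes> s = d \<otimes> s'\<close>.\<close>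

lemma frac_add_unique:
  assumes 1: "((s, r), (s1, r1)) \<in> ore_rel R S" and 2: "((s', r'), (s1', r1')) \<in> ore_rel R S"
    and c: "c \<in> carrier R" "d \<in> carrier R" "c \<otimes> s \<in> S" "c \<otimes> s = d \<otimes> s'"
    and c1: "c1 \<in> carrier R" "d1 \<in> carrier R" "c1 \<otimes> s1 \<in> S" "c1 \<otimes> s1 = d1 \<otimes> s1'"
  shows "frac (c \<otimes> s) (c \<otimes> r \<oplus> d \<otimes> r') = frac (c1 \<otimes> s1) (c1 \<otimes> r1 \<oplus> d1 \<otimes> r1')"
proof -
  have in_S: "s \<in> S" "s1 \<in> S" "s' \<in> S" "s1' \<in> S"
    and in_R: "r \<in> carrier R" "r1 \<in> carrier R" "r' \<in> carrier R" "r1' \<in> carrier R"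
    using 1 2 unfolding ore_rel_def by auto
  obtain a b where a: "a \<in> S" "b \<in> carrier R" "a \<otimes> (c \<otimes> s) = b \<otimes> (c1 \<otimes> s1)"
    using oreE[of "c \<otimes> s" "c1 \<otimes> s1"] in_S c c1 by auto
  have "(a \<otimes> c) \<otimes> s = (b \<otimes> c1) \<otimes> s1"
    using a in_S c c1 by (simp add: m_assoc)
  then obtain w where w: "w \<in> S" "w \<otimes> ((a \<otimes> c) \<otimes> r) = w \<otimes> ((b \<otimes> c1) \<otimes> r1)"
    using cross_multiply[OF 1, of "a \<otimes> c" "b \<otimes> c1"] a c c1 by auto
  have "a \<otimes> (d \<otimes> s') = b \<otimes> (d1 \<otimes> s1')"
    using a(3) c(4) c1(4) by simp
  then have "(w \<otimes> a \<otimes> d) \<otimes> s' = (w \<otimes> b \<otimes> d1) \<otimes> s1'"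
    using w a(1,2) in_S in_R c(1,2) c1(1,2) by (simp add: m_assoc)
  then obtain v where v: "v \<in> S" "v \<otimes> ((w \<otimes> a \<otimes> d) \<otimes> r') = v \<otimes> ((w \<otimes> b \<otimes> d1) \<otimes> r1')"
    using cross_multiply[OF 2, of "w \<otimes> a \<otimes> d" "w \<otimes> b \<otimes> d1"] w a c c1 by auto
  show ?thesis
  proof (rule frac_eqI[of _ _ _ _ "v \<otimes> w \<otimes> a" "v \<otimes> w \<otimes> b"])
    have "(v \<otimes> w \<otimes> a) \<otimes> (c \<otimes> r) = (v \<otimes> w \<otimes> b) \<otimes> (c1 \<otimes> r1)"
      using v(1) w a(1,2) in_S in_R c(1,2) c1(1,2) by (simp add: m_assoc)
    moreover have "(v \<otimes> w \<otimes> a) \<otimes> (d \<otimes> r') = (v \<otimes> w \<otimes> b) \<otimes> (d1 \<otimes> r1')"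
      using v w(1) a(1,2) in_S in_R c(1,2) c1(1,2) by (simp add: m_assoc)
    ultimately show "(v \<otimes> w \<otimes> a) \<otimes> (c \<otimes> r \<oplus> d \<otimes> r') = (v \<otimes> w \<otimes> b) \<otimes> (c1 \<otimes> r1 \<oplus> d1 \<otimes> r1')"
      using v(1) w(1) a(1,2) in_R c(1,2) c1(1,2) by (simp add: r_distr)
    show "(v \<otimes> w \<otimes> a) \<otimes> (c \<otimes> s) = (v \<otimes> w \<otimes> b) \<otimes> (c1 \<otimes> s1)"
      using v(1) w(1) a in_S c(1,2) c1(1,2) by (simp add: m_assoc)
  qed (use v w a in_S in_R c(1-3) c1(1-3) in auto)
qed

text \<open>Equal denominators are enough, since \<open>common_denominator\<close> reduces every sum
  to this case; the additive laws are then inherited from \<open>R\<close>.\<close>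

lemma frac_add:
  assumes "s \<in> S" "r \<in> carrier R" "r' \<in> carrier R"
  shows "frac s r \<oplus>\<^bsub>Loc\<^esub> frac s r' = frac s (r \<oplus> r')"
proof -
  have "{frac (c1 \<otimes> s1) (c1 \<otimes> r1 \<oplus> d1 \<otimes> r1') | s1 r1 s1' r1' c1 d1.
      (s1, r1) \<in> frac s r \<and> (s1', r1') \<in> frac s r' \<and> c1 \<in> carrier R \<and> d1 \<in> carrier R \<and>
      c1 \<otimes> s1 \<in> S \<and> c1 \<otimes> s1 = d1 \<otimes> s1'} = {frac s (r \<oplus> r')}" (is "?A = _")
  proof (intro equalityI subsetI)
    fix z assume "z \<in> ?A"
    then obtain s1 r1 s1' r1' c1 d1 where z: "z = frac (c1 \<otimes> s1) (c1 \<otimes> r1 \<oplus> d1 \<otimes> r1')"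
      "((s, r), (s1, r1)) \<in> ore_rel R S" "((s, r'), (s1', r1')) \<in> ore_rel R S"
      "c1 \<in> carrier R" "d1 \<in> carrier R" "c1 \<otimes> s1 \<in> S" "c1 \<otimes> s1 = d1 \<otimes> s1'"
      by (auto simp: mem_frac_iff)
    have "frac (\<one> \<otimes> s) (\<one> \<otimes> r \<oplus> \<one> \<otimes> r') = z"
      unfolding z(1) by (rule frac_add_unique[OF z(2,3) _ _ _ _ z(4-7)]) (use assms in auto)
    then show "z \<in> {frac s (r \<oplus> r')}"
      using assms by auto
  next
    fix z assume "z \<in> {frac s (r \<oplus> r')}"
    then have "z = frac (\<one> \<otimes> s) (\<one> \<otimes> r \<oplus> \<one> \<otimes> r')" "\<one> \<otimes> s \<in> S" "\<one> \<otimes> s = \<one> \<otimes> s"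
      using assms by auto
    then show "z \<in> ?A"
      using mem_frac_self[OF assms(1,2)] mem_frac_self[OF assms(1,3)] one_closed by blast
  qed
  then show ?thesis
    by (simp add: left_localization_def)
qed

lemma common_denominator:
  assumes "X \<in> carrier Loc" "Y \<in> carrier Loc"
  obtains s r r' where "s \<in> S" "r \<in> carrier R" "r' \<in> carrier R" "X = frac s r" "Y = frac s r'"
proof -
  obtain s r where s: "s \<in> S" "r \<in> carrier R" "X = frac s r"
    using LocE[OF assms(1)] by blast
  obtain s' r' where s': "s' \<in> S" "r' \<in> carrier R" "Y = frac s' r'"
    using LocE[OF assms(2)] by blast
  obtain t x where t: "t \<in> S" "x \<in> carrier R" "t \<otimes> s = x \<otimes> s'"
    using oreE[of s s'] s s' by auto
  have "X = frac (t \<otimes> s) (t \<otimes> r)"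
    using frac_expand[of s r t] s t(1,2) by simp
  \<comment> \<open>The multiplier \<open>x\<close> may lie outside \<open>S\<close>, but the
    product equals \<open>t \<otimes> s\<close>.\<close>
  moreover have "x \<otimes> s' \<in> S"
    using s t by (metis mult_in)
  then have "Y = frac (t \<otimes> s) (x \<otimes> r')"
    unfolding t(3) using frac_expand[of s' r' x] s' t(2) by simp
  ultimately show thesis
    using that[of "t \<otimes> s" "t \<otimes> r" "x \<otimes> r'"] s(1,2) s'(1,2) t(1,2) by simp
qed

lemma common_denominator3:
  assumes "X \<in> carrier Loc" "Y \<in> carrier Loc" "Z \<in> carrier Loc"
  obtains s x y z where "s \<in> S" "x \<in> carrier R" "y \<in> carrier R" "z \<in> carrier R"
    "X = frac s x" "Y = frac s y" "Z = frac s z"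
proof -
  obtain s x y where s: "s \<in> S" "x \<in> carrier R" "y \<in> carrier R" "X = frac s x" "Y = frac s y"
    using common_denominator[OF assms(1,2)] by blast
  obtain s' z where s': "s' \<in> S" "z \<in> carrier R" "Z = frac s' z"
    using LocE[OF assms(3)] by blast
  obtain t c where t: "t \<in> S" "c \<in> carrier R" "t \<otimes> s = c \<otimes> s'"
    using oreE[of s s'] s s' by auto
  have "c \<otimes> s' \<in> S"
    using s t by (metis mult_in)
  then have "Z = frac (t \<otimes> s) (c \<otimes> z)"
    unfolding t(3) using frac_expand[of s' z c] s' t(2) by simp
  moreover have "X = frac (t \<otimes> s) (t \<otimes> x)" "Y = frac (t \<otimes> s) (t \<otimes> y)"
    using frac_expand[of s x t] frac_expand[of s y t] s t(1,2) by simp_all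
  ultimately show thesis
    using that[of "t \<otimes> s" "t \<otimes> x" "t \<otimes> y" "c \<otimes> z"] s(1-3) s'(1,2) t(1,2) by simp
qed

section \<open>Ring axioms for the localization\<close>

lemma frac_zero: "s \<in> S \<Longrightarrow> frac s \<zero> = \<zero>\<^bsub>Loc\<^esub>"
  unfolding Loc_zero using frac_expand[of \<one> \<zero> s] by auto

lemma Loc_abelian_group: "abelian_group Loc"
proof (rule abelian_groupI)
  fix X Y assume XY: "X \<in> carrier Loc" "Y \<in> carrier Loc"
  obtain s r r' where s: "s \<in> S" "r \<in> carrier R" "r' \<in> carrier R" "X = frac s r" "Y = frac s r'"
    using common_denominator[OF XY] by blast
  then show "X \<oplus>\<^bsub>Loc\<^esub> Y \<in> carrier Loc" "X \<oplus>\<^bsub>Loc\<^esub> Y = Y \<oplus>\<^bsub>Loc\<^esub> X"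
    by (simp_all add: frac_add a_comm)
next
  show "\<zero>\<^bsub>Loc\<^esub> \<in> carrier Loc" by (simp add: Loc_zero)
next
  fix X Y Z assume XYZ: "X \<in> carrier Loc" "Y \<in> carrier Loc" "Z \<in> carrier Loc"
  obtain s x y z where "s \<in> S" "x \<in> carrier R" "y \<in> carrier R" "z \<in> carrier R"
    "X = frac s x" "Y = frac s y" "Z = frac s z"
    using common_denominator3[OF XYZ] by blast
  then show "X \<oplus>\<^bsub>Loc\<^esub> Y \<oplus>\<^bsub>Loc\<^esub> Z = X \<oplus>\<^bsub>Loc\<^esub> (Y \<oplus>\<^bsub>Loc\<^esub> Z)"
    by (simp add: frac_add a_assoc)
next
  fix X assume "X \<in> carrier Loc"
  then obtain s r where s: "s \<in> S" "r \<in> carrier R" "X = frac s r"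
    using LocE by blast
  then show "\<zero>\<^bsub>Loc\<^esub> \<oplus>\<^bsub>Loc\<^esub> X = X"
    using frac_add[of s \<zero> r] by (simp add: frac_zero)
  show "\<exists>Y\<in>carrier Loc. Y \<oplus>\<^bsub>Loc\<^esub> X = \<zero>\<^bsub>Loc\<^esub>"
    by (rule bexI[of _ "frac s (\<ominus> r)"]) (use s in \<open>simp_all add: frac_add frac_zero l_neg\<close>)
qed

lemma Loc_monoid: "monoid Loc"
proof (rule monoidI)
  show "\<one>\<^bsub>Loc\<^esub> \<in> carrier Loc" by (simp add: Loc_one)
next
  fix X Y assume "X \<in> carrier Loc" "Y \<in> carrier Loc"
  then obtain s r s' r' where s: "s \<in> S" "r \<in> carrier R" "X = frac s r"
    "s' \<in> S" "r' \<in> carrier R" "Y = frac s' r'"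
    using LocE by metis
  obtain t x where "t \<in> S" "x \<in> carrier R" "t \<otimes> r = x \<otimes> s'"
    using oreE[of r s'] s by auto
  then show "X \<otimes>\<^bsub>Loc\<^esub> Y \<in> carrier Loc"
    using s frac_mult[of s r s' r' t x] by auto
next
  fix X assume "X \<in> carrier Loc"
  then obtain s r where s: "s \<in> S" "r \<in> carrier R" "X = frac s r"
    using LocE by blast
  then show "\<one>\<^bsub>Loc\<^esub> \<otimes>\<^bsub>Loc\<^esub> X = X" "X \<otimes>\<^bsub>Loc\<^esub> \<one>\<^bsub>Loc\<^esub> = X"
    using frac_mult[of \<one> \<one> s r s \<one>] frac_mult[of s r \<one> \<one> \<one> r] by (auto simp: Loc_one)
next
  fix X Y Z assume "X \<in> carrier Loc" "Y \<in> carrier Loc" "Z \<in> carrier Loc"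
  then obtain s1 r1 s2 r2 s3 r3 where s: "s1 \<in> S" "r1 \<in> carrier R" "X = frac s1 r1"
    "s2 \<in> S" "r2 \<in> carrier R" "Y = frac s2 r2" "s3 \<in> S" "r3 \<in> carrier R" "Z = frac s3 r3"
    using LocE by metis
  obtain t y where t: "t \<in> S" "y \<in> carrier R" "t \<otimes> r2 = y \<otimes> s3"
    using oreE[of r2 s3] s by auto
  \<comment> \<open>The multipliers are chosen against \<open>t \<otimes> s2\<close>, the
    denominator of the product of \<open>Y\<close> and \<open>Z\<close>. In the form
    \<open>u\<close>, \<open>x \<otimes> t\<close> they also serve for \<open>X\<close> and
    \<open>Y\<close>, so both bracketings get the denominator \<open>u \<otimes> s1\<close>.\<close>
  obtain u x where u: "u \<in> S" "x \<in> carrier R" "u \<otimes> r1 = x \<otimes> (t \<otimes> s2)"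
    using oreE[of r1 "t \<otimes> s2"] s t by auto
  have "Y \<otimes>\<^bsub>Loc\<^esub> Z = frac (t \<otimes> s2) (y \<otimes> r3)"
    using frac_mult[of s2 r2 s3 r3 t y] s t by auto
  then have "X \<otimes>\<^bsub>Loc\<^esub> (Y \<otimes>\<^bsub>Loc\<^esub> Z) = frac (u \<otimes> s1) (x \<otimes> (y \<otimes> r3))"
    using frac_mult[of s1 r1 "t \<otimes> s2" "y \<otimes> r3" u x] s t u by auto
  moreover have "X \<otimes>\<^bsub>Loc\<^esub> Y = frac (u \<otimes> s1) (x \<otimes> t \<otimes> r2)"
    using frac_mult[of s1 r1 s2 r2 u "x \<otimes> t"] s t u by (auto simp: m_assoc)
  moreover have "\<one> \<otimes> (x \<otimes> t \<otimes> r2) = (x \<otimes> y) \<otimes> s3"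
    using s t u by (simp add: m_assoc)
  then have "frac (u \<otimes> s1) (x \<otimes> t \<otimes> r2) \<otimes>\<^bsub>Loc\<^esub> Z = frac (\<one> \<otimes> (u \<otimes> s1)) (x \<otimes> y \<otimes> r3)"
    unfolding s(9) by (intro frac_mult) (use s t u in auto)
  ultimately show "X \<otimes>\<^bsub>Loc\<^esub> Y \<otimes>\<^bsub>Loc\<^esub> Z = X \<otimes>\<^bsub>Loc\<^esub> (Y \<otimes>\<^bsub>Loc\<^esub> Z)"
    using s t u by (simp add: m_assoc)
qed

lemma Loc_ring: "ring Loc"
proof (rule ringI[OF Loc_abelian_group Loc_monoid])
  fix X Y Z assume XYZ: "X \<in> carrier Loc" "Y \<in> carrier Loc" "Z \<in> carrier Loc"
  obtain s x y where s: "s \<in> S" "x \<in> carrier R" "y \<in> carrier R" "X = frac s x" "Y = frac s y"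
    using common_denominator[OF XYZ(1,2)] by blast
  obtain u z where u: "u \<in> S" "z \<in> carrier R" "Z = frac u z"
    using LocE[OF XYZ(3)] by blast
  show "Z \<otimes>\<^bsub>Loc\<^esub> (X \<oplus>\<^bsub>Loc\<^esub> Y) = Z \<otimes>\<^bsub>Loc\<^esub> X \<oplus>\<^bsub>Loc\<^esub> Z \<otimes>\<^bsub>Loc\<^esub> Y"
  proof -
    obtain t c where t: "t \<in> S" "c \<in> carrier R" "t \<otimes> z = c \<otimes> s"
      using oreE[of z s] s u by auto
    show ?thesis
      using s u t by (simp add: frac_add r_distr frac_mult[where t=t and x=c])
  qed
  show "(X \<oplus>\<^bsub>Loc\<^esub> Y) \<otimes>\<^bsub>Loc\<^esub> Z = X \<otimes>\<^bsub>Loc\<^esub> Z \<oplus>\<^bsub>Loc\<^esub> Y \<otimes>\<^bsub>Loc\<^esub> Z"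
  proof -
    obtain t c where t: "t \<in> S" "c \<in> carrier R" "t \<otimes> x = c \<otimes> u"
      using oreE[of x u] s u by auto
    \<comment> \<open>The single multiplier \<open>t' \<otimes> t\<close> moves both
      \<open>x\<close> and \<open>y\<close> to left multiples of \<open>u\<close>, so all three
      products get the same denominator.\<close>
    obtain t' d where t': "t' \<in> S" "d \<in> carrier R" "t' \<otimes> (t \<otimes> y) = d \<otimes> u"
      using oreE[of "t \<otimes> y" u] s u t by auto
    have x: "(t' \<otimes> t) \<otimes> x = (t' \<otimes> c) \<otimes> u" and y: "(t' \<otimes> t) \<otimes> y = d \<otimes> u"
      using s u t t' by (simp_all add: m_assoc)
    have "(t' \<otimes> t) \<otimes> (x \<oplus> y) = (t' \<otimes> c \<oplus> d) \<otimes> u"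
      using s u t t' x y by (simp add: r_distr l_distr)
    then have "(X \<oplus>\<^bsub>Loc\<^esub> Y) \<otimes>\<^bsub>Loc\<^esub> Z = frac ((t' \<otimes> t) \<otimes> s) ((t' \<otimes> c \<oplus> d) \<otimes> z)"
      using s u t t' by (simp add: frac_add frac_mult)
    moreover have "X \<otimes>\<^bsub>Loc\<^esub> Z = frac ((t' \<otimes> t) \<otimes> s) ((t' \<otimes> c) \<otimes> z)"
      unfolding s(4) u(3) by (rule frac_mult[OF _ _ _ _ _ _ x]) (use s u t t' in auto)
    moreover have "Y \<otimes>\<^bsub>Loc\<^esub> Z = frac ((t' \<otimes> t) \<otimes> s) (d \<otimes> z)"
      unfolding s(5) u(3) by (rule frac_mult[OF _ _ _ _ _ _ y]) (use s u t t' in auto)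
    ultimately show ?thesis
      using s u t t' by (simp add: frac_add l_distr)
  qed
qed

section \<open>The canonical map into the localization\<close>

lemma to_localization_hom: "to_localization R S \<in> ring_hom R Loc"
proof (rule ring_hom_memI)
  fix x y assume xy: "x \<in> carrier R" "y \<in> carrier R"
  show "to_localization R S (x \<otimes> y) = to_localization R S x \<otimes>\<^bsub>Loc\<^esub> to_localization R S y"
    using frac_mult[of \<one> x \<one> y \<one> x] xy by (simp add: to_localization_def)
  show "to_localization R S (x \<oplus> y) = to_localization R S x \<oplus>\<^bsub>Loc\<^esub> to_localization R S y"
    using frac_add[of \<one> x y] xy by (simp add: to_localization_def)
qed (simp_all add: to_localization_def Loc_one)

text \<open>With both denominators equal to \<open>\<one>\<close> the two multipliers coincide and
  lie in \<open>S\<close>, so the relation to the zero fraction says that some element of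
  \<open>S\<close> kills \<open>r\<close>.\<close>

lemma to_localization_eq_zero_iff:
  assumes "r \<in> carrier R"
  shows "to_localization R S r = \<zero>\<^bsub>Loc\<^esub> \<longleftrightarrow> r \<in> ass R S"
proof -
  have "to_localization R S r = \<zero>\<^bsub>Loc\<^esub> \<longleftrightarrow> ((\<one>, r), (\<one>, \<zero>)) \<in> ore_rel R S"
    unfolding to_localization_def Loc_zero using assms by (simp add: frac_eq_iff)
  also have "\<dots> \<longleftrightarrow> r \<in> ass R S"
    unfolding ore_rel_def ass_def using assms in_carrier by auto
  finally show ?thesis .
qed

lemma to_localization_mult_frac:
  assumes "s \<in> S" "r \<in> carrier R"
  shows "to_localization R S s \<otimes>\<^bsub>Loc\<^esub> frac s r = to_localization R S r"
  using frac_mult[of \<one> s s r \<one> \<one>] assms by (simp add: to_localization_def)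

lemma to_localization_unit:
  assumes "s \<in> S"
  shows "to_localization R S s \<in> Units Loc"
proof -
  have "to_localization R S s \<otimes>\<^bsub>Loc\<^esub> frac s \<one> = \<one>\<^bsub>Loc\<^esub>"
    using to_localization_mult_frac[of s \<one>] assms by (simp add: to_localization_def Loc_one)
  moreover have "frac s \<one> \<otimes>\<^bsub>Loc\<^esub> to_localization R S s = frac s s"
    using frac_mult[of s \<one> \<one> s \<one> \<one>] assms by (simp add: to_localization_def)
  moreover have "frac s s = \<one>\<^bsub>Loc\<^esub>"
    using frac_expand[of \<one> \<one> s] assms by (simp add: Loc_one)
  ultimately show ?thesis
    unfolding Units_def using assms
    by (auto simp: to_localization_def intro!: bexI[of _ "frac s \<one>"])
qed

text \<open>A fraction with invertible denominator \<open>s\<close> is already the image of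
  \<open>inv s \<otimes> r\<close>, and a unit can be cancelled from an equation between
  images.\<close>

lemma to_localization_iso_of_units:
  assumes "S \<subseteq> Units R"
  shows "to_localization R S \<in> ring_iso R Loc"
proof -
  have "inj_on (to_localization R S) (carrier R)"
  proof (rule inj_onI)
    fix x y assume xy: "x \<in> carrier R" "y \<in> carrier R" "to_localization R S x = to_localization R S y"
    then have "((\<one>, x), (\<one>, y)) \<in> ore_rel R S"
      unfolding to_localization_def by (simp add: frac_eq_iff)
    then obtain c where "c \<in> S" "c \<otimes> x = c \<otimes> y"
      unfolding ore_rel_def by auto
    then show "x = y"
      using assms xy by (auto simp: Units_l_cancel)
  qed
  moreover have "to_localization R S ` carrier R = carrier Loc"
  proof (intro equalityI subsetI)
    fix X assume "X \<in> carrier Loc"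
    then obtain s r where s: "s \<in> S" "r \<in> carrier R" "X = frac s r"
      using LocE by blast
    then have u: "s \<in> Units R" using assms by auto
    have "frac s r = frac \<one> (inv s \<otimes> r)"
      by (rule frac_eqI[of _ _ _ _ \<one> s]) (use s u in \<open>simp_all flip: m_assoc\<close>)
    then have "X = to_localization R S (inv s \<otimes> r)"
      using s by (simp add: to_localization_def)
    then show "X \<in> to_localization R S ` carrier R"
      using s u by auto
  qed (auto simp: to_localization_def)
  ultimately show ?thesis
    using to_localization_hom unfolding ring_iso_def bij_betw_def by auto
qed

end

section \<open>Maximal left denominator sets\<close>

text \<open>Words grow on the right, so induction peels off the rightmost factor, which is the one
  that the Ore and reversibility conditions treat first.\<close>

inductive_set submonoid_span :: "('a, 'm) monoid_scheme \<Rightarrow> 'a set \<Rightarrow> 'a set"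
  for G and X where
  one: "\<one>\<^bsub>G\<^esub> \<in> submonoid_span G X"
| mult: "m \<in> submonoid_span G X \<Longrightarrow> x \<in> X \<Longrightarrow> m \<otimes>\<^bsub>G\<^esub> x \<in> submonoid_span G X"

lemma submonoid_span_least:
  fixes G (structure)
  assumes "\<one> \<in> N" "X \<subseteq> N" "\<And>x y. x \<in> N \<Longrightarrow> y \<in> N \<Longrightarrow> x \<otimes> y \<in> N"
  shows "submonoid_span G X \<subseteq> N"
proof
  show "m \<in> N" if "m \<in> submonoid_span G X" for m
    using that by induction (use assms in auto)
qed

context monoid
begin

lemma submonoid_span_subset: "X \<subseteq> carrier G \<Longrightarrow> submonoid_span G X \<subseteq> carrier G"
  by (rule submonoid_span_least) auto

lemma subset_submonoid_span: "X \<subseteq> carrier G \<Longrightarrow> X \<subseteq> submonoid_span G X"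
  using submonoid_span.mult[OF submonoid_span.one, of _ X G] by force

lemma submonoid_span_mult:
  assumes "X \<subseteq> carrier G" "a \<in> submonoid_span G X" "b \<in> submonoid_span G X"
  shows "a \<otimes> b \<in> submonoid_span G X"
  using assms(3)
proof induction
  case one
  then show ?case using submonoid_span_subset[OF assms(1)] assms(2) by (simp add: subset_iff)
next
  case (mult m x)
  have "a \<in> carrier G" "m \<in> carrier G" "x \<in> carrier G"
    using submonoid_span_subset[OF assms(1)] assms(1,2) mult.hyps by blast+
  then have "a \<otimes> (m \<otimes> x) = (a \<otimes> m) \<otimes> x" by (simp add: m_assoc)
  then show ?case using mult by (simp add: submonoid_span.mult)
qed

end

context ring
begin

text \<open>Each factor of a word is handled by the denominator set it comes from, and the left
  multipliers gained on the way multiply up inside the span.\<close>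

lemma submonoid_span_Den_l:
  assumes F: "F \<subseteq> Den_l R" and zero: "\<zero> \<notin> submonoid_span R (\<Union>F)"
  shows "submonoid_span R (\<Union>F) \<in> Den_l R"
proof (rule Den_l_I)
  have X: "\<Union>F \<subseteq> carrier R" using F Den_l_subset by blast
  let ?N = "submonoid_span R (\<Union>F)"
  have N: "?N \<subseteq> carrier R" by (rule submonoid_span_subset[OF X])
  show "?N \<subseteq> carrier R" "\<one> \<in> ?N" "\<zero> \<notin> ?N" by (fact N submonoid_span.one zero)+
  show "x \<otimes> y \<in> ?N" if "x \<in> ?N" "y \<in> ?N" for x y
    by (rule submonoid_span_mult[OF X that])
  show "\<exists>t\<in>?N. \<exists>x\<in>carrier R. t \<otimes> r = x \<otimes> m" if "r \<in> carrier R" "m \<in> ?N" for r m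
    using that(2,1)
  \<comment> \<open>The element \<open>r\<close> varies because moving past the last factor replaces
    it by \<open>y\<close>.\<close>
  proof (induction arbitrary: r)
    case one
    then show ?case by (intro bexI[of _ \<one>] bexI[of _ r]) (auto intro: submonoid_span.one)
  next
    case (mult m x)
    obtain D where D: "D \<in> Den_l R" "D \<subseteq> \<Union>F" "x \<in> D" using F mult.hyps(2) by blast
    obtain t y where t: "t \<in> D" "y \<in> carrier R" "t \<otimes> r = y \<otimes> x"
      using Den_l_ore[OF D(1) mult.prems D(3)] by blast
    obtain t' z where t': "t' \<in> ?N" "z \<in> carrier R" "t' \<otimes> y = z \<otimes> m"
      using mult.IH[OF t(2)] by blast
    have in_R: "m \<in> carrier R" "x \<in> carrier R" "t \<in> carrier R" "t' \<in> carrier R"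
      using N X D t t' mult.hyps by blast+
    have "(t' \<otimes> t) \<otimes> r = t' \<otimes> (t \<otimes> r)" using in_R mult.prems by (simp add: m_assoc)
    also have "\<dots> = (t' \<otimes> y) \<otimes> x" unfolding t(3) using in_R t(2) by (simp add: m_assoc)
    also have "\<dots> = z \<otimes> (m \<otimes> x)" unfolding t'(3) using in_R t'(2) by (simp add: m_assoc)
    finally have "(t' \<otimes> t) \<otimes> r = z \<otimes> (m \<otimes> x)" .
    moreover have "t' \<otimes> t \<in> ?N" using t(1) t'(1) D(2) by (auto intro: submonoid_span.mult)
    ultimately show ?case using t'(2) by blast
  qed
  show "\<exists>t\<in>?N. t \<otimes> r = \<zero>" if "r \<in> carrier R" "m \<in> ?N" "r \<otimes> m = \<zero>" for r m
    using that(2,1,3)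
  proof (induction arbitrary: r)
    case one
    then show ?case by (intro bexI[of _ \<one>]) (auto intro: submonoid_span.one)
  next
    case (mult m x)
    obtain D where D: "D \<in> Den_l R" "D \<subseteq> \<Union>F" "x \<in> D" using F mult.hyps(2) by blast
    have in_R: "m \<in> carrier R" "x \<in> carrier R" using N X D mult.hyps by blast+
    have "(r \<otimes> m) \<otimes> x = \<zero>" using in_R mult.prems by (simp add: m_assoc)
    then obtain t where t: "t \<in> D" "t \<otimes> (r \<otimes> m) = \<zero>"
      using Den_l_reversible[OF D(1) _ D(3), of "r \<otimes> m"] in_R mult.prems by auto
    have t_R: "t \<in> carrier R" using t(1) D X by blast
    have "(t \<otimes> r) \<otimes> m = \<zero>" using t(2) t_R in_R mult.prems by (simp add: m_assoc)
    then obtain t' where t': "t' \<in> ?N" "t' \<otimes> (t \<otimes> r) = \<zero>"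
      using mult.IH[of "t \<otimes> r"] t_R mult.prems by auto
    have "(t' \<otimes> t) \<otimes> r = \<zero>"
      using t' t_R N mult.prems by (simp add: m_assoc subset_iff)
    moreover have "t' \<otimes> t \<in> ?N" using t(1) t'(1) D(2) by (auto intro: submonoid_span.mult)
    ultimately show ?case by blast
  qed
qed

end

text \<open>Each condition involves at most two elements of the union, and these lie in one member
  of the chain. Nonemptiness supplies \<open>\<one>\<close>.\<close>

lemma Den_l_Union_chain:
  fixes R (structure)
  assumes "C \<noteq> {}" "subset.chain (Den_l R) C"
  shows "\<Union>C \<in> Den_l R"
proof (rule Den_l_I)
  have C: "C \<subseteq> Den_l R" and chain: "\<And>X Y. X \<in> C \<Longrightarrow> Y \<in> C \<Longrightarrow> X \<subseteq> Y \<or> Y \<subseteq> X"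
    using assms(2) by (auto simp: subset_chain_def)
  show "\<Union>C \<subseteq> carrier R" "\<zero> \<notin> \<Union>C" using C Den_l_subset Den_l_zero by blast+
  show "\<one> \<in> \<Union>C" using assms(1) C Den_l_one by blast
  show "x \<otimes> y \<in> \<Union>C" if xy: "x \<in> \<Union>C" "y \<in> \<Union>C" for x y
  proof -
    obtain X Y where "X \<in> C" "Y \<in> C" "x \<in> X" "y \<in> Y" using xy by blast
    then obtain D where D: "D \<in> C" "x \<in> D" "y \<in> D" using chain[of X Y] by blast
    then have "x \<otimes> y \<in> D" using C by (intro Den_l_mult) auto
    then show ?thesis using D(1) by blast
  qed
  show "\<exists>t\<in>\<Union>C. \<exists>x\<in>carrier R. t \<otimes> r = x \<otimes> s" if rs: "r \<in> carrier R" "s \<in> \<Union>C" for r s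
  proof -
    obtain D where D: "D \<in> C" "s \<in> D" using rs by blast
    then have "\<exists>t\<in>D. \<exists>x\<in>carrier R. t \<otimes> r = x \<otimes> s" using C rs by (intro Den_l_ore) auto
    then show ?thesis using D by blast
  qed
  show "\<exists>t\<in>\<Union>C. t \<otimes> r = \<zero>" if rs: "r \<in> carrier R" "s \<in> \<Union>C" "r \<otimes> s = \<zero>" for r s
  proof -
    obtain D where D: "D \<in> C" "s \<in> D" using rs by blast
    then have "\<exists>t\<in>D. t \<otimes> r = \<zero>" using C rs by (intro Den_l_reversible) auto
    then show ?thesis using D by blast
  qed
qed

lemma max_Den_lE:
  assumes "S \<in> Den_l R"
  obtains M where "M \<in> max_Den_l R" "S \<subseteq> M"
proof -
  \<comment> \<open>Zorn's lemma is applied above \<open>S\<close>; a maximal element there is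
    maximal in all of \<open>Den_l R\<close>, since its supersets contain \<open>S\<close> as
    well.\<close>
  let ?A = "{D \<in> Den_l R. S \<subseteq> D}"
  have "\<exists>M\<in>?A. \<forall>X\<in>?A. M \<subseteq> X \<longrightarrow> X = M"
  proof (rule subset_Zorn_nonempty)
    show "?A \<noteq> {}" using assms by blast
    show "\<Union>C \<in> ?A" if "C \<noteq> {}" "subset.chain ?A C" for C
    proof -
      have "subset.chain (Den_l R) C" "\<forall>D\<in>C. S \<subseteq> D"
        using that(2) unfolding subset_chain_def by auto
      then show ?thesis using Den_l_Union_chain[OF that(1)] that(1) by blast
    qed
  qed
  then obtain M where "M \<in> Den_l R" "S \<subseteq> M" "\<forall>X\<in>?A. M \<subseteq> X \<longrightarrow> X = M" by blast
  then show thesis using that[of M] unfolding max_Den_l_def by blast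
qed

lemma max_Den_l_eq: "M \<in> max_Den_l R \<Longrightarrow> D \<in> Den_l R \<Longrightarrow> M \<subseteq> D \<Longrightarrow> D = M"
  unfolding max_Den_l_def by blast

lemma max_Den_l_Den_l: "M \<in> max_Den_l R \<Longrightarrow> M \<in> Den_l R"
  unfolding max_Den_l_def by blast

lemma T_l_subset_Lls: "T_l R \<subseteq> Lls R"
  unfolding T_l_def by blast

section \<open>Denominator sets with zero \<open>ass\<close>, the set \<open>T_l\<close> and the
  units\<close>

context ring
begin

text \<open>Regular elements can be cancelled from a product of elements of \<open>M\<close> and \<open>S\<close>, so the
  submonoid generated by \<open>M \<union> S\<close> avoids zero and hence is a left denominator set.\<close>

lemma regular_Den_l_subset_max:
  assumes S: "S \<in> Den_l R" "ass R S = {\<zero>}" and M: "M \<in> max_Den_l R"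
  shows "S \<subseteq> M"
proof -
  let ?N = "submonoid_span R (\<Union>{M, S})"
  note M' = max_Den_l_Den_l[OF M]
  have X: "\<Union>{M, S} \<subseteq> carrier R" using Den_l_subset[OF S(1)] Den_l_subset[OF M'] by simp
  \<comment> \<open>A claim strong enough for induction: a last factor from \<open>S\<close> is
    dropped because \<open>ass R S\<close> is zero, one from \<open>M\<close> by reversibility,
    which puts an element of \<open>M\<close> on the left. The case \<open>m = \<zero>\<close>,
    \<open>x = \<one>\<close> would place \<open>\<zero>\<close> in \<open>M\<close>.\<close>
  have kill: "\<exists>s\<in>M. s \<otimes> x = \<zero>" if "m \<in> ?N" "x \<in> carrier R" "x \<otimes> m = \<zero>" for m x
    using that
  proof (induction arbitrary: x)
    case one
    then show ?case using Den_l_one[OF M'] by (intro bexI[of _ \<one>]) auto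
  next
    case (mult m y)
    have in_R: "m \<in> carrier R" "y \<in> carrier R"
      using mult.hyps X submonoid_span_subset[OF X] by blast+
    have xm: "(x \<otimes> m) \<otimes> y = \<zero>" using in_R mult.prems by (simp add: m_assoc)
    show ?case
    proof (cases "y \<in> S")
      case True
      then obtain t where "t \<in> S" "t \<otimes> (x \<otimes> m) = \<zero>"
        using Den_l_reversible[OF S(1) _ True xm] in_R mult.prems by auto
      then have "x \<otimes> m \<in> ass R S" unfolding ass_def using in_R mult.prems by auto
      then show ?thesis using S(2) mult by auto
    next
      case False
      then have "y \<in> M" using mult.hyps by auto
      then obtain t where t: "t \<in> M" "t \<otimes> (x \<otimes> m) = \<zero>"
        using Den_l_reversible[OF M' _ _ xm] in_R mult.prems by auto
      then have t_R: "t \<in> carrier R" using X by auto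
      then have "(t \<otimes> x) \<otimes> m = \<zero>" using t in_R mult.prems by (simp add: m_assoc)
      then obtain s where s: "s \<in> M" "s \<otimes> (t \<otimes> x) = \<zero>"
        using mult.IH[of "t \<otimes> x"] t_R mult.prems by auto
      then have "s \<in> carrier R" using X by auto
      then have "(s \<otimes> t) \<otimes> x = \<zero>" using s t_R mult.prems by (simp add: m_assoc)
      then show ?thesis using Den_l_mult[OF M' s(1) t(1)] by blast
    qed
  qed
  have "\<zero> \<notin> ?N"
  proof
    assume "\<zero> \<in> ?N"
    then obtain s where s: "s \<in> M" "s \<otimes> \<one> = \<zero>" using kill[of \<zero> \<one>] by auto
    then have "s \<in> carrier R" using X by auto
    then show False using s Den_l_zero[OF M'] by auto
  qed
  then have N: "?N \<in> Den_l R"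
    using S(1) M' by (intro submonoid_span_Den_l) auto
  have sub: "M \<subseteq> ?N" "S \<subseteq> ?N" using subset_submonoid_span[OF X] by auto
  then have "?N = M" using max_Den_l_eq[OF M N] by blast
  then show ?thesis using sub by blast
qed

lemma regular_Den_l_subset_T_l:
  assumes "S \<in> Den_l R" "ass R S = {\<zero>}"
  shows "S \<subseteq> T_l R"
  using regular_Den_l_subset_max[OF assms] assms(1) unfolding T_l_def Lls_def by blast

text \<open>Every denominator set with zero \<open>ass\<close> lies in \<open>T_l R\<close>; once
  \<open>T_l R\<close> is one of them, it is the greatest.\<close>

lemma T_l_eq_S_l0:
  assumes "T_l R \<in> Den_l R" "ass R (T_l R) = {\<zero>}"
  shows "T_l R = S_l0 R"
  unfolding S_l0_def
  by (rule Greatest_equality[symmetric]) (use assms regular_Den_l_subset_T_l in auto)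

text \<open>The submonoid generated by the sets in the union stays inside \<open>Lls R\<close>, an
  intersection of submonoids, hence avoids \<open>\<zero>\<close> and is a denominator set. So it is
  itself a member of the family and equals the union.\<close>

lemma T_l_Den_l:
  assumes "\<one> \<noteq> \<zero>"
  shows "T_l R \<in> Den_l R"
proof -
  \<comment> \<open>A maximal set has to exist: the intersection of the empty family would be the
    whole type and contain \<open>\<zero>\<close>.\<close>
  have "{\<one>} \<in> Den_l R" using assms by (intro Den_l_I) auto
  then obtain M where M: "M \<in> max_Den_l R" by (rule max_Den_lE)
  let ?F = "{S \<in> Den_l R. S \<subseteq> Lls R}"
  have sub: "submonoid_span R (\<Union>?F) \<subseteq> Lls R"
  proof (rule submonoid_span_least)
    show "\<one> \<in> Lls R" unfolding Lls_def using max_Den_l_Den_l Den_l_one by blast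
    show "x \<otimes> y \<in> Lls R" if "x \<in> Lls R" "y \<in> Lls R" for x y
      using that unfolding Lls_def by (auto intro: Den_l_mult[OF max_Den_l_Den_l])
  qed auto
  moreover have "\<zero> \<notin> Lls R"
    unfolding Lls_def using M Den_l_zero[OF max_Den_l_Den_l[OF M]] by blast
  ultimately have N: "submonoid_span R (\<Union>?F) \<in> Den_l R"
    by (intro submonoid_span_Den_l) auto
  have "\<Union>?F \<subseteq> submonoid_span R (\<Union>?F)"
    by (rule subset_submonoid_span) (use Den_l_subset in blast)
  then have "\<Union>?F = submonoid_span R (\<Union>?F)" using sub N by blast
  then show ?thesis using N unfolding T_l_def by simp
qed

lemma Units_mult_eq_zeroD:
  assumes "u \<in> Units R" "x \<in> carrier R" "u \<otimes> x = \<zero>"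
  shows "x = \<zero>"
proof -
  have "x = inv u \<otimes> (u \<otimes> x)"
    using assms(1,2) by (simp add: Units_closed flip: m_assoc)
  then show ?thesis using assms by simp
qed

lemma Units_Den_l:
  assumes "\<one> \<noteq> \<zero>"
  shows "Units R \<in> Den_l R" "ass R (Units R) = {\<zero>}"
proof -
  show "ass R (Units R) = {\<zero>}"
  proof
    show "ass R (Units R) \<subseteq> {\<zero>}" unfolding ass_def using Units_mult_eq_zeroD by blast
    show "{\<zero>} \<subseteq> ass R (Units R)" unfolding ass_def using bexI[of _ \<one> "Units R"] by simp
  qed
  show "Units R \<in> Den_l R"
  proof (rule Den_l_I)
    show "\<zero> \<notin> Units R" using Units_mult_eq_zeroD[of \<zero> \<one>] assms by auto
    fix r s assume rs: "r \<in> carrier R" "s \<in> Units R"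
    have "\<one> \<otimes> r = (r \<otimes> inv s) \<otimes> s" using rs by (simp add: m_assoc Units_closed)
    then show "\<exists>t\<in>Units R. \<exists>x\<in>carrier R. t \<otimes> r = x \<otimes> s"
      using rs by (intro bexI[of _ \<one>] bexI[of _ "r \<otimes> inv s"]) auto
    show "\<exists>t\<in>Units R. t \<otimes> r = \<zero>" if "r \<otimes> s = \<zero>"
    proof
      have "r = (r \<otimes> s) \<otimes> inv s" using rs by (simp add: m_assoc Units_closed)
      then show "\<one> \<otimes> r = \<zero>" using that rs by simp
    qed auto
  qed auto
qed

end

section \<open>Transfer along a homomorphism with denominators\<close>

text \<open>Both \<open>R \<rightarrow> R / ass T\<close> and \<open>R \<rightarrow> T\<inverse>R\<close> are of this kind.\<close>

locale denominator_hom = ring_hom_ring R Q h for R (structure) and Q (structure) and h +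
  fixes T
  assumes T_Den: "T \<in> Den_l R"
    and kernel: "r \<in> carrier R \<Longrightarrow> h r = \<zero>\<^bsub>Q\<^esub> \<longleftrightarrow> r \<in> ass R T"
    and denominator: "q \<in> carrier Q \<Longrightarrow> \<exists>t\<in>T. \<exists>r\<in>carrier R. h t \<otimes>\<^bsub>Q\<^esub> q = h r"
    and cancel_left: "t \<in> T \<Longrightarrow> q \<in> carrier Q \<Longrightarrow> h t \<otimes>\<^bsub>Q\<^esub> q = \<zero>\<^bsub>Q\<^esub> \<Longrightarrow> q = \<zero>\<^bsub>Q\<^esub>"
begin

sublocale T: left_denominator R T
  by unfold_locales (rule T_Den)

text \<open>The kernel is \<open>ass R T\<close>, so applying it to \<open>a \<ominus> b\<close>
  lifts an equation in \<open>Q\<close> to one in \<open>R\<close>, up to a left factor from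
  \<open>T\<close>.\<close>

lemma hom_eqE:
  assumes ab: "a \<in> carrier R" "b \<in> carrier R" "h a = h b"
  obtains u where "u \<in> T" "u \<otimes> a = u \<otimes> b"
proof -
  have "h (a \<ominus> b) = \<zero>\<^bsub>Q\<^esub>" using ab by (simp add: R.minus_eq S.r_neg)
  then have "a \<ominus> b \<in> ass R T" using kernel[of "a \<ominus> b"] ab by simp
  then obtain u where u: "u \<in> T" "u \<otimes> (a \<ominus> b) = \<zero>" by (rule T.mem_assE)
  then have "u \<otimes> a \<ominus> u \<otimes> b = \<zero>"
    using ab by (simp add: R.minus_eq R.r_distr R.r_minus)
  then have "u \<otimes> a = u \<otimes> b"
    using ab u(1) by simp
  with u(1) show thesis by (rule that)
qed

lemma denominatorE:
  assumes "q \<in> carrier Q"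
  obtains t r where "t \<in> T" "r \<in> carrier R" "h t \<otimes>\<^bsub>Q\<^esub> q = h r"
  using denominator[OF assms] by blast

text \<open>Witnesses found in \<open>Q\<close> are lifted by clearing denominators with elements of
  \<open>T\<close>. They stay in \<open>D\<close> because \<open>D\<close> contains the image of
  \<open>T\<close>, and \<open>hom_eqE\<close> or \<open>kernel\<close> lifts the equations.\<close>

lemma preimage_Den_l:
  assumes D: "D \<in> Den_l Q" "h ` T \<subseteq> D"
  shows "{r \<in> carrier R. h r \<in> D} \<in> Den_l R"
proof (rule Den_l_I)
  let ?P = "{r \<in> carrier R. h r \<in> D}"
  have T_P: "t \<in> ?P" if "t \<in> T" for t using that D(2) by auto
  have D_Q: "d \<in> carrier Q" if "d \<in> D" for d using that Den_l_subset[OF D(1)] by blast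
  show "?P \<subseteq> carrier R" "\<one> \<in> ?P" "\<zero> \<notin> ?P"
    using Den_l_one[OF D(1)] Den_l_zero[OF D(1)] by auto
  show P_mult: "x \<otimes> y \<in> ?P" if "x \<in> ?P" "y \<in> ?P" for x y
    using that Den_l_mult[OF D(1)] by auto
  fix r s assume r: "r \<in> carrier R" and s: "s \<in> ?P"
  show "\<exists>p\<in>?P. \<exists>x\<in>carrier R. p \<otimes> r = x \<otimes> s"
  proof -
    obtain d y where d: "d \<in> D" "y \<in> carrier Q" "d \<otimes>\<^bsub>Q\<^esub> h r = y \<otimes>\<^bsub>Q\<^esub> h s"
      using Den_l_ore[OF D(1), of "h r" "h s"] r s by auto
    \<comment> \<open>Denominators are cleared one after the other: \<open>t\<close> lifts
      \<open>y\<close>, and \<open>t'\<close> then lifts the product of \<open>h t\<close> and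
      \<open>d\<close>, so that one left factor suits both sides of the Ore equation.\<close>
    obtain t r2 where t: "t \<in> T" "r2 \<in> carrier R" "h t \<otimes>\<^bsub>Q\<^esub> y = h r2"
      using denominatorE[OF d(2)] by blast
    have td: "h t \<otimes>\<^bsub>Q\<^esub> d \<in> D" using Den_l_mult[OF D(1)] T_P[OF t(1)] d(1) by auto
    obtain t' r1 where t': "t' \<in> T" "r1 \<in> carrier R" "h t' \<otimes>\<^bsub>Q\<^esub> (h t \<otimes>\<^bsub>Q\<^esub> d) = h r1"
      using denominatorE[OF D_Q[OF td]] by blast
    have in_Q: "d \<in> carrier Q" "h t \<in> carrier Q" "h t' \<in> carrier Q" "h r \<in> carrier Q"
      "h s \<in> carrier Q" "h r2 \<in> carrier Q"
      using d t t' r s D_Q by auto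
    have r1: "r1 \<in> ?P" using t' td Den_l_mult[OF D(1)] T_P[OF t'(1)] by (simp flip: t'(3))
    have "h (r1 \<otimes> r) = h t' \<otimes>\<^bsub>Q\<^esub> (h t \<otimes>\<^bsub>Q\<^esub> (d \<otimes>\<^bsub>Q\<^esub> h r))"
      using in_Q r t'(2) by (simp add: S.m_assoc flip: t'(3))
    also have "\<dots> = h t' \<otimes>\<^bsub>Q\<^esub> ((h t \<otimes>\<^bsub>Q\<^esub> y) \<otimes>\<^bsub>Q\<^esub> h s)"
      unfolding d(3) using in_Q d(2) by (simp add: S.m_assoc)
    also have "\<dots> = h (t' \<otimes> r2 \<otimes> s)"
      unfolding t(3) using t'(1) t(2) s in_Q by (simp add: S.m_assoc)
    finally obtain u where u: "u \<in> T" "u \<otimes> (r1 \<otimes> r) = u \<otimes> (t' \<otimes> r2 \<otimes> s)"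
      using hom_eqE[of "r1 \<otimes> r" "t' \<otimes> r2 \<otimes> s"] r t' t s by auto
    have "(u \<otimes> r1) \<otimes> r = u \<otimes> (r1 \<otimes> r)"
      using u(1) r t'(2) by (simp add: R.m_assoc)
    also have "\<dots> = (u \<otimes> t' \<otimes> r2) \<otimes> s"
      unfolding u(2) using u(1) s t'(1) t(2) by (simp add: R.m_assoc)
    finally show ?thesis
      using P_mult[OF T_P[OF u(1)] r1] u(1) t'(1) t(2)
      by (intro bexI[of _ "u \<otimes> r1"] bexI[of _ "u \<otimes> t' \<otimes> r2"]) simp_all
  qed
  show "\<exists>p\<in>?P. p \<otimes> r = \<zero>" if rs: "r \<otimes> s = \<zero>"
  proof -
    have "h r \<otimes>\<^bsub>Q\<^esub> h s = \<zero>\<^bsub>Q\<^esub>" using r s rs by (simp flip: hom_mult)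
    then obtain d where d: "d \<in> D" "d \<otimes>\<^bsub>Q\<^esub> h r = \<zero>\<^bsub>Q\<^esub>"
      using Den_l_reversible[OF D(1), of "h r" "h s"] r s by auto
    obtain t r1 where t: "t \<in> T" "r1 \<in> carrier R" "h t \<otimes>\<^bsub>Q\<^esub> d = h r1"
      using denominatorE[OF D_Q[OF d(1)]] by blast
    have r1: "r1 \<in> ?P" using t d(1) Den_l_mult[OF D(1)] T_P[OF t(1)] by (simp flip: t(3))
    have "h (r1 \<otimes> r) = h t \<otimes>\<^bsub>Q\<^esub> (d \<otimes>\<^bsub>Q\<^esub> h r)"
      using t(1,2) r D_Q[OF d(1)] by (simp add: S.m_assoc flip: t(3))
    then have "h (r1 \<otimes> r) = \<zero>\<^bsub>Q\<^esub>" using t(1) by (simp add: d(2))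
    then have "r1 \<otimes> r \<in> ass R T" using kernel[of "r1 \<otimes> r"] t(2) r by (simp del: hom_mult)
    then obtain u where u: "u \<in> T" "u \<otimes> (r1 \<otimes> r) = \<zero>" by (rule T.mem_assE)
    then have "(u \<otimes> r1) \<otimes> r = \<zero>" using r t(2) by (simp add: R.m_assoc)
    then show ?thesis using P_mult[OF T_P[OF u(1)] r1] by blast
  qed
qed

text \<open>An element \<open>q\<close> is replaced by a numerator \<open>r\<close>, where
  \<open>h r\<close> is \<open>h t\<close> times \<open>q\<close>, and the conditions are applied to
  \<open>r\<close> in \<open>R\<close>. The denominator \<open>t\<close> is absorbed into
  \<open>S\<close> because \<open>T \<subseteq> S\<close>.\<close>

lemma image_Den_l:
  assumes S: "S \<in> Den_l R" "T \<subseteq> S"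
  shows "h ` S \<in> Den_l Q"
proof (rule Den_l_I)
  interpret S': left_denominator R S by unfold_locales (rule S(1))
  show "h ` S \<subseteq> carrier Q" by auto
  show "\<one>\<^bsub>Q\<^esub> \<in> h ` S" using hom_one S'.one_in by (metis imageI)
  show "\<zero>\<^bsub>Q\<^esub> \<notin> h ` S"
  proof
    assume "\<zero>\<^bsub>Q\<^esub> \<in> h ` S"
    then obtain s where s: "s \<in> S" "h s = \<zero>\<^bsub>Q\<^esub>" by auto
    then have "s \<in> ass R T" using kernel by simp
    then obtain t where "t \<in> T" "t \<otimes> s = \<zero>" by (rule T.mem_assE)
    then show False using S'.mult_in[of t s] s(1) S(2) S'.zero_notin by auto
  qed
  show "x \<otimes>\<^bsub>Q\<^esub> y \<in> h ` S" if xy: "x \<in> h ` S" "y \<in> h ` S" for x y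
  proof -
    obtain a b where "a \<in> S" "b \<in> S" "x = h a" "y = h b" using xy by blast
    then have "x \<otimes>\<^bsub>Q\<^esub> y = h (a \<otimes> b)" "a \<otimes> b \<in> S" by auto
    then show ?thesis by blast
  qed
  fix q y assume q: "q \<in> carrier Q" and "y \<in> h ` S"
  then obtain s where s: "s \<in> S" "y = h s" by blast
  obtain t r where t: "t \<in> T" "r \<in> carrier R" "h t \<otimes>\<^bsub>Q\<^esub> q = h r"
    using denominatorE[OF q] by blast
  have t_S: "t \<in> S" using t(1) S(2) by blast
  show "\<exists>z\<in>h ` S. \<exists>x\<in>carrier Q. z \<otimes>\<^bsub>Q\<^esub> q = x \<otimes>\<^bsub>Q\<^esub> y"
  proof -
    obtain s1 x where s1: "s1 \<in> S" "x \<in> carrier R" "s1 \<otimes> r = x \<otimes> s"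
      using S'.oreE[OF t(2) s(1)] by blast
    have "h (s1 \<otimes> t) \<otimes>\<^bsub>Q\<^esub> q = h s1 \<otimes>\<^bsub>Q\<^esub> h r"
      using s1(1) t(1) q by (simp add: S.m_assoc flip: t(3))
    also have "\<dots> = h (s1 \<otimes> r)" using s1(1) t(2) by simp
    also have "\<dots> = h x \<otimes>\<^bsub>Q\<^esub> y" unfolding s1(3) s(2) using s1(2) s(1) by simp
    finally show ?thesis
      using S'.mult_in[OF s1(1) t_S] s1(2)
      by (intro bexI[of _ "h (s1 \<otimes> t)"] bexI[of _ "h x"]) simp_all
  qed
  show "\<exists>z\<in>h ` S. z \<otimes>\<^bsub>Q\<^esub> q = \<zero>\<^bsub>Q\<^esub>" if qy: "q \<otimes>\<^bsub>Q\<^esub> y = \<zero>\<^bsub>Q\<^esub>"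
  proof -
    have "h (r \<otimes> s) = h t \<otimes>\<^bsub>Q\<^esub> (q \<otimes>\<^bsub>Q\<^esub> y)"
      unfolding s(2) using t(1,2) s(1) q by (simp add: S.m_assoc flip: t(3))
    \<comment> \<open>In \<open>R\<close> the product vanishes only after a left factor
      \<open>u \<in> T\<close>, so reversibility of \<open>S\<close> is used for
      \<open>u \<otimes> r\<close>.\<close>
    then have "r \<otimes> s \<in> ass R T" using kernel[of "r \<otimes> s"] qy t(1,2) s(1) by simp
    then obtain u where u: "u \<in> T" "u \<otimes> (r \<otimes> s) = \<zero>" by (rule T.mem_assE)
    have "(u \<otimes> r) \<otimes> s = \<zero>" using u t(2) s(1) by (simp add: R.m_assoc)
    then obtain v where v: "v \<in> S" "v \<otimes> (u \<otimes> r) = \<zero>"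
      using S'.reversible[of "u \<otimes> r" s] u(1) t(2) s(1) by auto
    have "h (v \<otimes> u \<otimes> t) \<otimes>\<^bsub>Q\<^esub> q = h (v \<otimes> u) \<otimes>\<^bsub>Q\<^esub> h r"
      using v(1) u(1) t(1) q by (simp add: S.m_assoc flip: t(3))
    also have "\<dots> = h (v \<otimes> (u \<otimes> r))" using v(1) u(1) t(2) by (simp add: S.m_assoc)
    also have "\<dots> = \<zero>\<^bsub>Q\<^esub>" unfolding v(2) by simp
    finally show ?thesis
      using S'.mult_in[OF S'.mult_in[OF v(1)] t_S] u(1) S(2) by blast
  qed
qed

section \<open>Maximal denominator sets and \<open>T_l\<close> under the homomorphism\<close>

lemma ass_image_T: "ass Q (h ` T) = {\<zero>\<^bsub>Q\<^esub>}"
proof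
  show "ass Q (h ` T) \<subseteq> {\<zero>\<^bsub>Q\<^esub>}" unfolding ass_def using cancel_left by auto
  have "h \<one> \<in> h ` T" by blast
  then show "{\<zero>\<^bsub>Q\<^esub>} \<subseteq> ass Q (h ` T)" unfolding ass_def by auto
qed

lemma image_T_Den_l: "h ` T \<in> Den_l Q"
  by (rule image_Den_l[OF T_Den]) simp

lemma image_T_subset_max: "M \<in> max_Den_l Q \<Longrightarrow> h ` T \<subseteq> M"
  by (rule S.regular_Den_l_subset_max[OF image_T_Den_l ass_image_T])

lemma image_T_subset_T_l: "h ` T \<subseteq> T_l Q"
  by (rule S.regular_Den_l_subset_T_l[OF image_T_Den_l ass_image_T])

lemma codomain_nontrivial: "\<one>\<^bsub>Q\<^esub> \<noteq> \<zero>\<^bsub>Q\<^esub>"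
  using Den_l_one[OF image_T_Den_l] Den_l_zero[OF image_T_Den_l] by auto

text \<open>The image of \<open>M\<close> is extended to a maximal \<open>M'\<close>. The preimage
  of \<open>M'\<close> is a denominator set containing \<open>M\<close>, so maximality of
  \<open>M\<close> makes them equal.\<close>

lemma max_Den_l_preimageE:
  assumes M: "M \<in> max_Den_l R" "T \<subseteq> M"
  obtains M' where "M' \<in> max_Den_l Q" "M = {r \<in> carrier R. h r \<in> M'}"
proof -
  obtain M' where M': "M' \<in> max_Den_l Q" "h ` M \<subseteq> M'"
    using max_Den_lE[OF image_Den_l[OF max_Den_l_Den_l[OF M(1)] M(2)]] by blast
  have "M \<subseteq> {r \<in> carrier R. h r \<in> M'}"
    using M'(2) Den_l_subset[OF max_Den_l_Den_l[OF M(1)]] by auto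
  then have "{r \<in> carrier R. h r \<in> M'} = M"
    using max_Den_l_eq[OF M(1) preimage_Den_l] max_Den_l_Den_l[OF M'(1)]
      image_T_subset_max[OF M'(1)] by blast
  then show thesis using that[OF M'(1)] by simp
qed

text \<open>Every maximal set of \<open>R\<close> is the preimage of a maximal set of
  \<open>Q\<close>, so \<open>h r\<close> lying in all of the latter puts \<open>r\<close> in all of
  the former.\<close>

lemma preimage_Lls_subset:
  assumes "T \<subseteq> Lls R"
  shows "{r \<in> carrier R. h r \<in> Lls Q} \<subseteq> Lls R"
proof -
  have "{r \<in> carrier R. h r \<in> Lls Q} \<subseteq> M" if M: "M \<in> max_Den_l R" for M
  proof -
    have "T \<subseteq> M" using assms M unfolding Lls_def by blast
    then obtain M' where "M' \<in> max_Den_l Q" "M = {r \<in> carrier R. h r \<in> M'}"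
      using max_Den_l_preimageE[OF M] by blast
    then show ?thesis unfolding Lls_def by blast
  qed
  then show ?thesis unfolding Lls_def by blast
qed

text \<open>For the converse inclusion the preimage of a maximal \<open>M'\<close> is extended to a
  maximal \<open>M\<close>. Surjectivity puts \<open>M'\<close> inside the image of
  \<open>M\<close>, and maximality of \<open>M'\<close> makes them equal.\<close>

lemma preimage_Lls:
  assumes "T \<subseteq> Lls R" and surj: "h ` carrier R = carrier Q"
  shows "{r \<in> carrier R. h r \<in> Lls Q} = Lls R"
proof
  show "Lls R \<subseteq> {r \<in> carrier R. h r \<in> Lls Q}"
  proof
    fix r assume r: "r \<in> Lls R"
    \<comment> \<open>Some maximal set is required to see that elements of the intersection lie in
      \<open>carrier R\<close>.\<close>
    obtain M where "M \<in> max_Den_l R" using max_Den_lE[OF T_Den] by blast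
    then have "r \<in> carrier R"
      using r Den_l_subset[OF max_Den_l_Den_l] unfolding Lls_def by blast
    moreover have "h r \<in> M'" if M': "M' \<in> max_Den_l Q" for M'
    proof -
      have "{r \<in> carrier R. h r \<in> M'} \<in> Den_l R"
        by (rule preimage_Den_l[OF max_Den_l_Den_l[OF M'] image_T_subset_max[OF M']])
      then obtain M where M: "M \<in> max_Den_l R" "{r \<in> carrier R. h r \<in> M'} \<subseteq> M"
        by (rule max_Den_lE)
      have "T \<subseteq> M" using assms(1) M(1) unfolding Lls_def by blast
      then have "h ` M \<in> Den_l Q" using image_Den_l max_Den_l_Den_l[OF M(1)] by blast
      moreover have "M' \<subseteq> h ` M"
      proof
        fix x assume x: "x \<in> M'"
        then have "x \<in> h ` carrier R"
          unfolding surj using Den_l_subset[OF max_Den_l_Den_l[OF M']] by blast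
        then show "x \<in> h ` M" using x M(2) by blast
      qed
      ultimately have "h ` M = M'" by (rule max_Den_l_eq[OF M'])
      moreover have "r \<in> M" using r M(1) unfolding Lls_def by blast
      ultimately show ?thesis by blast
    qed
    ultimately show "r \<in> {r \<in> carrier R. h r \<in> Lls Q}" unfolding Lls_def by blast
  qed
qed (rule preimage_Lls_subset[OF assms(1)])

text \<open>The preimage of \<open>T_l Q\<close> is a denominator set inside \<open>Lls R\<close>,
  hence one of the sets whose union is \<open>T_l R\<close>.\<close>

lemma preimage_T_l:
  assumes "T = T_l R"
  shows "{r \<in> carrier R. h r \<in> T_l Q} = T"
proof
  have "{r \<in> carrier R. h r \<in> T_l Q} \<subseteq> {r \<in> carrier R. h r \<in> Lls Q}"
    using T_l_subset_Lls[of Q] by blast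
  also have "\<dots> \<subseteq> Lls R"
    unfolding assms by (rule preimage_Lls_subset) (use T_l_subset_Lls assms in simp)
  finally show "{r \<in> carrier R. h r \<in> T_l Q} \<subseteq> T"
    using preimage_Den_l[OF S.T_l_Den_l[OF codomain_nontrivial] image_T_subset_T_l]
    unfolding assms T_l_def[of R] by blast
  show "T \<subseteq> {r \<in> carrier R. h r \<in> T_l Q}"
    using image_T_subset_T_l by auto
qed

end

section \<open>The quotient by \<open>ass R S\<close> and the localization as instances\<close>

context left_denominator
begin

text \<open>The projection is surjective, so \<open>\<one>\<close> serves as denominator. Left
  cancellation holds because \<open>u \<otimes> (t \<otimes> r) = \<zero>\<close> with
  \<open>u\<close> and \<open>t\<close> in \<open>S\<close> already puts \<open>r\<close> into
  \<open>ass R S\<close>.\<close>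

lemma quotient_denominator_hom:
  "denominator_hom R (R Quot (ass R S)) (\<lambda>r. ass R S +> r) S"
proof -
  interpret I: ideal "ass R S" R by (rule ass_ideal)
  note hom = I.rcos_ring_hom_ring
  have zero: "\<zero>\<^bsub>R Quot (ass R S)\<^esub> = ass R S" by (simp add: FactRing_def)
  have kernel: "ass R S +> r = ass R S \<longleftrightarrow> r \<in> ass R S" if "r \<in> carrier R" for r
    using that I.rcos_const_imp_mem[of r] I.a_rcos_const[of r] by blast
  have mult: "ass R S +> (x \<otimes> y) = (ass R S +> x) \<otimes>\<^bsub>R Quot (ass R S)\<^esub> (ass R S +> y)"
    if "x \<in> carrier R" "y \<in> carrier R" for x y
    by (rule ring_hom_mult[OF ring_hom_ring.homh[OF hom] that])
  show ?thesis
  proof (intro denominator_hom.intro denominator_hom_axioms.intro)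
    show "ring_hom_ring R (R Quot (ass R S)) (\<lambda>r. ass R S +> r)" by (rule hom)
    show "S \<in> Den_l R" by (rule den)
    show "ass R S +> r = \<zero>\<^bsub>R Quot (ass R S)\<^esub> \<longleftrightarrow> r \<in> ass R S" if "r \<in> carrier R" for r
      unfolding zero by (rule kernel[OF that])
    fix q assume "q \<in> carrier (R Quot (ass R S))"
    then obtain r where r: "r \<in> carrier R" "q = ass R S +> r"
      by (auto simp: FactRing_def A_RCOSETS_def')
    show "\<exists>t\<in>S. \<exists>r\<in>carrier R. (ass R S +> t) \<otimes>\<^bsub>R Quot (ass R S)\<^esub> q = ass R S +> r"
      unfolding r(2) using mult[OF one_closed r(1)] r(1)
      by (intro bexI[of _ \<one>] bexI[of _ r]) simp_all
    show "q = \<zero>\<^bsub>R Quot (ass R S)\<^esub>"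
      if t: "t \<in> S" "(ass R S +> t) \<otimes>\<^bsub>R Quot (ass R S)\<^esub> q = \<zero>\<^bsub>R Quot (ass R S)\<^esub>" for t
    proof -
      have "ass R S +> (t \<otimes> r) = (ass R S +> t) \<otimes>\<^bsub>R Quot (ass R S)\<^esub> q"
        unfolding r(2) by (rule mult[OF in_carrier[OF t(1)] r(1)])
      also have "\<dots> = ass R S" using t(2) unfolding zero .
      finally have "t \<otimes> r \<in> ass R S"
        unfolding kernel[OF m_closed[OF in_carrier[OF t(1)] r(1)]] .
      then obtain u where u: "u \<in> S" "u \<otimes> (t \<otimes> r) = \<zero>" by (rule mem_assE)
      then have "r \<in> ass R S"
        using mem_assI[of "u \<otimes> t" r] t(1) r(1) by (simp add: m_assoc)
      then show ?thesis unfolding zero r(2) kernel[OF r(1)] .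
    qed
  qed
qed

lemma localization_denominator_hom: "denominator_hom R Loc (to_localization R S) S"
proof -
  interpret Loc: ring Loc by (rule Loc_ring)
  show ?thesis
  proof unfold_locales
    show "to_localization R S \<in> ring_hom R Loc" by (rule to_localization_hom)
    show "S \<in> Den_l R" by (rule den)
    show "to_localization R S r = \<zero>\<^bsub>Loc\<^esub> \<longleftrightarrow> r \<in> ass R S" if "r \<in> carrier R" for r
      by (rule to_localization_eq_zero_iff[OF that])
    fix q assume q: "q \<in> carrier Loc"
    then obtain s r where "s \<in> S" "r \<in> carrier R" "q = frac s r" by (rule LocE)
    then show "\<exists>t\<in>S. \<exists>r\<in>carrier R. to_localization R S t \<otimes>\<^bsub>Loc\<^esub> q = to_localization R S r"
      using to_localization_mult_frac by blast
    show "q = \<zero>\<^bsub>Loc\<^esub>" if "t \<in> S" "to_localization R S t \<otimes>\<^bsub>Loc\<^esub> q = \<zero>\<^bsub>Loc\<^esub>" for t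
      by (rule Loc.Units_mult_eq_zeroD[OF to_localization_unit[OF that(1)] q that(2)])
  qed
qed

text \<open>Clearing the denominator of \<open>q \<in> T_l Loc\<close> gives the image of some
  \<open>r\<close>, which \<open>preimage_T_l\<close> places in \<open>S\<close>; so
  \<open>q\<close> is a quotient of two units. Conversely, the units form a denominator set with
  zero \<open>ass\<close>.\<close>

lemma T_l_Loc:
  assumes "S = T_l R"
  shows "T_l Loc = Units Loc"
proof
  interpret denominator_hom R Loc "to_localization R S" S
    by (rule localization_denominator_hom)
  show "Units Loc \<subseteq> T_l Loc"
    by (rule S.regular_Den_l_subset_T_l[OF S.Units_Den_l[OF codomain_nontrivial]])
  note T_Loc = S.T_l_Den_l[OF codomain_nontrivial]
  show "T_l Loc \<subseteq> Units Loc"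
  proof
    fix q assume q: "q \<in> T_l Loc"
    then have q_Loc: "q \<in> carrier Loc" using Den_l_subset[OF T_Loc] by blast
    obtain t r where t: "t \<in> S" "r \<in> carrier R"
      "to_localization R S t \<otimes>\<^bsub>Loc\<^esub> q = to_localization R S r"
      using denominatorE[OF q_Loc] by blast
    have "to_localization R S t \<in> T_l Loc" using image_T_subset_T_l t(1) by blast
    then have "to_localization R S r \<in> T_l Loc"
      using Den_l_mult[OF T_Loc _ q] t(3) by metis
    then have "r \<in> S" using preimage_T_l[OF assms] t(2) by blast
    then have r: "to_localization R S r \<in> Units Loc" by (rule to_localization_unit)
    have u: "to_localization R S t \<in> Units Loc" by (rule to_localization_unit[OF t(1)])
    have "q = inv\<^bsub>Loc\<^esub> (to_localization R S t) \<otimes>\<^bsub>Loc\<^esub> to_localization R S r"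
      unfolding t(3)[symmetric] using u q_Loc by (simp add: S.Units_closed flip: S.m_assoc)
    then show "q \<in> Units Loc" using u r by simp
  qed
qed

end

section \<open>Assembly of the seven items from the two instances\<close>

theorem theorem1p2:
  fixes R :: "('a, 'm) ring_scheme"
    and Rbar :: "'a set ring"
    and \<pi> :: "'a \<Rightarrow> 'a set"
  assumes "ring R" and "\<one>\<^bsub>R\<^esub> \<noteq> \<zero>\<^bsub>R\<^esub>"
  defines "Rbar \<equiv> R Quot (lls R)"
    and "\<pi> \<equiv> (\<lambda>r. lls R +>\<^bsub>R\<^esub> r)"
  shows
    "to_localization (Qls R) (T_l (Qls R)) \<in> ring_iso (Qls R) (Qls (Qls R)) \<and>
     (T_l Rbar = \<pi> ` T_l R \<and> T_l R = {r \<in> carrier R. \<pi> r \<in> T_l Rbar}) \<and>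
     T_l Rbar = S_l0 Rbar \<and>
     lls Rbar = {\<zero>\<^bsub>Rbar\<^esub>} \<and>
     (T_l (Qls R) = Units (Qls R) \<and> lls (Qls R) = {\<zero>\<^bsub>Qls R\<^esub>}) \<and>
     (\<pi> ` Lls R = Lls Rbar \<and> Lls R = {r \<in> carrier R. \<pi> r \<in> Lls Rbar}) \<and>
     Qls Rbar = Ql Rbar"
proof -
  interpret R: ring R by fact
  have "T_l R \<in> Den_l R" by (rule R.T_l_Den_l[OF assms(2)])
  then interpret T: left_denominator R "T_l R" by unfold_locales
  interpret \<pi>: denominator_hom R Rbar \<pi> "T_l R"
    unfolding Rbar_def \<pi>_def lls_def by (rule T.quotient_denominator_hom)
  interpret \<sigma>: denominator_hom R "Qls R" "to_localization R (T_l R)" "T_l R"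
    unfolding Qls_def by (rule T.localization_denominator_hom)
  have surj: "\<pi> ` carrier R = carrier Rbar"
    by (auto simp: \<pi>_def Rbar_def FactRing_def A_RCOSETS_def')
  \<comment> \<open>By surjectivity of \<open>\<pi>\<close> the image halves of items 2 and 6 follow
    from the preimage halves.\<close>
  have image_of_preimage: "\<pi> ` {r \<in> carrier R. \<pi> r \<in> A} = A" if "A \<subseteq> carrier Rbar" for A
  proof -
    have "A \<subseteq> \<pi> ` carrier R" using that surj by simp
    then show ?thesis by blast
  qed

  have T_Rbar: "T_l Rbar \<in> Den_l Rbar" by (rule \<pi>.S.T_l_Den_l[OF \<pi>.codomain_nontrivial])
  have T_pre: "{r \<in> carrier R. \<pi> r \<in> T_l Rbar} = T_l R" by (rule \<pi>.preimage_T_l) simp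
  have T_img: "T_l Rbar = \<pi> ` T_l R"
    using image_of_preimage[OF Den_l_subset[OF T_Rbar]] T_pre by simp
  have ass_T: "ass Rbar (T_l Rbar) = {\<zero>\<^bsub>Rbar\<^esub>}" unfolding T_img by (rule \<pi>.ass_image_T)
  have S_l0: "T_l Rbar = S_l0 Rbar" by (rule \<pi>.S.T_l_eq_S_l0[OF T_Rbar ass_T])

  obtain M where "M \<in> max_Den_l Rbar" using max_Den_lE[OF T_Rbar] by blast
  then have L_sub: "Lls Rbar \<subseteq> carrier Rbar"
    unfolding Lls_def using Den_l_subset[OF max_Den_l_Den_l] by blast
  have L_pre: "{r \<in> carrier R. \<pi> r \<in> Lls Rbar} = Lls R"
    by (rule \<pi>.preimage_Lls[OF T_l_subset_Lls surj])
  have L_img: "\<pi> ` Lls R = Lls Rbar" using image_of_preimage[OF L_sub] L_pre by simp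

  have T_Q: "T_l (Qls R) = Units (Qls R)" unfolding Qls_def by (rule T.T_l_Loc[OF refl])
  note U_Q = \<sigma>.S.Units_Den_l[OF \<sigma>.codomain_nontrivial]
  interpret U: left_denominator "Qls R" "Units (Qls R)" by unfold_locales (rule U_Q(1))
  \<comment> \<open>Item 1: by \<open>T_Q\<close> the second localization inverts only elements that
    are units already.\<close>
  have "to_localization (Qls R) (T_l (Qls R)) \<in> ring_iso (Qls R) (Qls (Qls R))"
    unfolding Qls_def[of "Qls R"] T_Q by (rule U.to_localization_iso_of_units) simp
  \<comment> \<open>Item 7 follows from item 3: both rings are localizations of \<open>Rbar\<close>
    at the same set.\<close>
  then show ?thesis
    using T_img T_pre S_l0 ass_T T_Q U_Q(2) L_img L_pre
    by (simp add: lls_def Ql_def Qls_def[of Rbar])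
qed

end
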